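(* For any $\mu\geq -1/2$ and any $x\in[0,\pi]$, \[ \left|\Im\left( e^{ix\mu} L(x,\mu)\right)\right|\leq \operatorname{arccot}\left((2\mu+1)\sin \frac{x}{2}\right), \] with equality if $\mu=-1/2$ or $x=0$.
   Context: For $0<x\le\pi$ and $\mu>-1$, $L(x,\mu)=\sum_{k=1}^\infty \frac{e^{ikx}}{k+\mu}$. At $x=0$ the quantity $\Im\left(e^{ix\mu}L(x,\mu)\right)$ is understood as its limit as $x\to0^+$ (which equals $\pi/2$). *)

theory Defs
  imports "HOL-Analysis.Analysis"
begin

text \<open>L(x,mu) = sum_{k>=1} e^{ikx}/(k+mu), for 0 < x <= pi and mu > -1
  (a conditionally convergent series; suminf is the limit of partial sums).\<close>
definition L :: "real \<Rightarrow> real \<Rightarrow> complex" where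
  "L x \<mu> = (\<Sum>k. exp (\<i> * of_real (real (Suc k) * x)) / of_real (real (Suc k) + \<mu>))"

definition ImL :: "real \<Rightarrow> real \<Rightarrow> real" where
  "ImL x \<mu> = (if x = 0
     then Lim (at_right 0) (\<lambda>t. Im (exp (\<i> * of_real (t * \<mu>)) * L t \<mu>))
     else Im (exp (\<i> * of_real (x * \<mu>)) * L x \<mu>))"

definition arccot :: "real \<Rightarrow> real" where
  "arccot y = pi / 2 - arctan y"

end

theory Submission
  imports Defs "HOL-Real_Asymp.Real_Asymp"
begin

text \<open>
  Put \<open>\<nu> = \<mu> + 1/2 \<ge> 0\<close>, \<open>s = sin (x/2)\<close> and \<open>a = 2 \<nu> s\<close>, so that the bound is \<open>arccot a\<close>, and let \<open>F\<close> be the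
  quantity to estimate, as a function of \<open>x\<close>. Writing \<open>1/(k + \<mu>)\<close> as a Laplace integral and summing the
  geometric series turns the complex sum into the integral of
  \<open>K(z) = exp (i \<nu> z) / (exp (-i z/2) - exp (i z/2))\<close> along the vertical half-line above \<open>x\<close>. As \<open>K\<close> is
  holomorphic, \<open>F'(x) = Re K(x) = - sin (\<nu> x) / (2 sin (x/2))\<close>; moreover \<open>F\<close> tends to \<open>\<pi>/2\<close> at \<open>0\<close>.

  If \<open>a \<ge> 2\<close>, taking norms under the integral gives
  \<open>\<bar>F\<bar> \<le> \<integral> exp (- a v) / sqrt (1 + v\<^sup>2) dv \<le> 3 a / (3 a\<^sup>2 + 1) \<le> arccot a\<close>.
  If \<open>a \<le> 2\<close>, the upper bound follows by comparing the derivatives of \<open>F\<close> and \<open>arccot a\<close>, which agree to first order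
  at \<open>x = 0\<close>. For the lower bound, \<open>\<nu> x \<le> \<pi>\<close> and \<open>F\<close> decreases as long as this holds, so it is enough to treat
  \<open>x = min \<pi> (\<pi>/\<nu>)\<close>: there \<open>a \<ge> 2\<close> if \<open>\<nu> \<ge> 1\<close>, while for \<open>\<nu> < 1\<close> the integral at \<open>x = \<pi>\<close> is
  \<open>cos (\<nu> \<pi>) \<integral> exp (- \<nu> y) / (2 cosh (y/2)) dy\<close>.

  All integrals are truncated at a finite height \<open>Y\<close>; the error is at most \<open>4 exp (- Y/2)\<close>, uniformly in \<open>x\<close>.
\<close>

section \<open>Summation of the series by a vertical integral\<close>

text \<open>The sum of the geometric series with terms
  \<open>exp (\<i> * (n + 1/2 + \<nu>) * z)\<close>, n \<ge> 0, for Im z > 0. The half-integer shift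
  makes the denominator symmetric: it is \<open>-2 * \<i> * sin (z / 2)\<close>.\<close>

definition kern :: "real \<Rightarrow> complex \<Rightarrow> complex" where
  "kern \<nu> z = exp (\<i> * of_real \<nu> * z) / (exp (- \<i> * z / 2) - exp (\<i> * z / 2))"

lemma exp_halves:
  "exp (- \<i> * Complex x y / 2) - exp (\<i> * Complex x y / 2) =
   Complex (2 * cos (x / 2) * sinh (y / 2)) (- 2 * sin (x / 2) * cosh (y / 2))"
  by (auto simp: complex_eq_iff exp_eq_polar Re_exp Im_exp sinh_def cosh_def algebra_simps)

lemma cos_sinh_sin_cosh:
  fixes x y :: real
  shows "(cos x * sinh y)\<^sup>2 + (sin x * cosh y)\<^sup>2 = (sin x)\<^sup>2 + (sinh y)\<^sup>2"
  by (simp add: power_mult_distrib cosh_square_eq cos_squared_eq algebra_simps)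

lemma norm_exp_halves:
  "norm (exp (- \<i> * Complex x y / 2) - exp (\<i> * Complex x y / 2)) =
   2 * sqrt ((sin (x / 2))\<^sup>2 + (sinh (y / 2))\<^sup>2)"
proof -
  have "norm (exp (- \<i> * Complex x y / 2) - exp (\<i> * Complex x y / 2)) =
    sqrt (4 * ((cos (x / 2) * sinh (y / 2))\<^sup>2 + (sin (x / 2) * cosh (y / 2))\<^sup>2))"
    unfolding exp_halves cmod_def by (simp add: power_mult_distrib algebra_simps)
  then show ?thesis by (simp only: cos_sinh_sin_cosh real_sqrt_mult) simp
qed

lemma norm_kern:
  "norm (kern \<nu> (Complex x y)) = exp (- \<nu> * y) / (2 * sqrt ((sin (x / 2))\<^sup>2 + (sinh (y / 2))\<^sup>2))"
  unfolding kern_def norm_divide norm_exp_halves by simp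

lemma exp_halves_nonzero:
  assumes "0 < x" "x < 2 * pi"
  shows "exp (- \<i> * Complex x y / 2) - exp (\<i> * Complex x y / 2) \<noteq> 0"
proof -
  have "sin (x / 2) > 0" using assms by (intro sin_gt_zero) auto
  then have "(sin (x / 2))\<^sup>2 + (sinh (y / 2))\<^sup>2 > 0" by (simp add: add_pos_nonneg)
  then show ?thesis using norm_exp_halves[of x y] by auto
qed

text \<open>Multiplication by the conjugate of the denominator. The real part at
  \<open>y = 0\<close> will be the horizontal derivative of the integral, the imaginary part is its
  integrand.\<close>

lemma kern_eq:
  "kern \<nu> (Complex x y) =
   of_real (exp (- \<nu> * y) / (2 * ((sin (x / 2))\<^sup>2 + (sinh (y / 2))\<^sup>2))) *
   Complex (cos (\<nu> * x) * (cos (x / 2) * sinh (y / 2)) - sin (\<nu> * x) * (sin (x / 2) * cosh (y / 2)))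
           (sin (\<nu> * x) * (cos (x / 2) * sinh (y / 2)) + cos (\<nu> * x) * (sin (x / 2) * cosh (y / 2)))"
proof -
  define C S where "C = cos (x / 2) * sinh (y / 2)" and "S = sin (x / 2) * cosh (y / 2)"
  have E: "exp (\<i> * of_real \<nu> * Complex x y) = of_real (exp (- \<nu> * y)) * Complex (cos (\<nu> * x)) (sin (\<nu> * x))"
    by (auto simp: complex_eq_iff Re_exp Im_exp)
  have H: "exp (- \<i> * Complex x y / 2) - exp (\<i> * Complex x y / 2) = Complex (2 * C) (- 2 * S)"
    unfolding exp_halves C_def S_def by simp
  define K where "K = C\<^sup>2 + S\<^sup>2"
  have "(2 * C)\<^sup>2 + (2 * S)\<^sup>2 = 4 * K" by (simp add: power_mult_distrib K_def)
  then have I: "inverse (Complex (2 * C) (- 2 * S)) = of_real (1 / (2 * K)) * Complex C S"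
    by (simp add: complex_eq_iff del: power_mult_distrib power_mult_numeral)
  have M: "of_real e * Complex p q * (of_real d * Complex C S) =
     of_real (e * d) * Complex (p * C - q * S) (q * C + p * S)" for e p q d
    by (simp add: complex_eq_iff algebra_simps)
  have "K = (sin (x / 2))\<^sup>2 + (sinh (y / 2))\<^sup>2"
    unfolding K_def C_def S_def by (rule cos_sinh_sin_cosh)
  then have K: "1 / (2 * K) = 1 / (2 * ((sin (x / 2))\<^sup>2 + (sinh (y / 2))\<^sup>2))" by simp
  have "kern \<nu> (Complex x y) = of_real (exp (- \<nu> * y)) * Complex (cos (\<nu> * x)) (sin (\<nu> * x)) *
     inverse (Complex (2 * C) (- 2 * S))"
    unfolding kern_def E H by (rule divide_inverse)
  also have "\<dots> = of_real (exp (- \<nu> * y) * (1 / (2 * K))) *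
     Complex (cos (\<nu> * x) * C - sin (\<nu> * x) * S) (sin (\<nu> * x) * C + cos (\<nu> * x) * S)"
    unfolding I by (rule M)
  finally show ?thesis unfolding K C_def S_def times_divide_eq_right mult_1_right .
qed

text \<open>Telescoping: each summand is \<open>kern \<nu> z\<close> times the difference of two
  consecutive powers of \<open>exp (\<i> * z)\<close>.\<close>

lemma sum_exp_eq_kern:
  assumes "exp (- \<i> * z / 2) - exp (\<i> * z / 2) \<noteq> 0"
  shows "(\<Sum>n<N. exp (\<i> * of_real (real n + 1/2 + \<nu>) * z)) = kern \<nu> z * (1 - exp (\<i> * z * of_nat N))"
proof (induction N)
  case 0
  then show ?case by simp
next
  case (Suc N)
  define d where "d = exp (- \<i> * z / 2) - exp (\<i> * z / 2)"
  have k: "kern \<nu> z = exp (\<i> * of_real \<nu> * z) / d" unfolding kern_def d_def ..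
  have "exp (\<i> * of_real (real N + 1/2 + \<nu>) * z) =
     exp (\<i> * of_real \<nu> * z) * exp (\<i> * z * of_nat N) * exp (\<i> * z / 2)"
    unfolding exp_add[symmetric] by (rule arg_cong[of _ _ exp]) (simp add: algebra_simps)
  moreover have "d * exp (\<i> * z / 2) = 1 - exp (\<i> * z)"
    unfolding d_def left_diff_distrib exp_add[symmetric] by (simp add: field_simps)
  then have "exp (\<i> * z / 2) = (1 - exp (\<i> * z)) / d"
    using assms by (simp add: d_def field_simps)
  moreover have "exp (\<i> * z * of_nat (Suc N)) = exp (\<i> * z * of_nat N) * exp (\<i> * z)"
    unfolding exp_add[symmetric] by (rule arg_cong[of _ _ exp]) (simp add: algebra_simps)
  ultimately have "exp (\<i> * of_real (real N + 1/2 + \<nu>) * z) = kern \<nu> z * (exp (\<i> * z * of_nat N) - exp (\<i> * z * of_nat (Suc N)))"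
    unfolding k by (simp only:) (simp add: right_diff_distrib diff_divide_distrib)
  then show ?case unfolding sum.lessThan_Suc Suc
    by (simp only: right_diff_distrib add_diff_eq diff_add_cancel)
qed

lemma continuous_on_kern:
  assumes "0 < x" "x < 2 * pi"
  shows "continuous_on A (\<lambda>y. kern \<nu> (Complex x y))"
  unfolding kern_def
proof (rule continuous_on_divide)
  show "continuous_on A (\<lambda>y. exp (- \<i> * Complex x y / 2) - exp (\<i> * Complex x y / 2))"
    unfolding Complex_eq by (intro continuous_intros) auto
  show "continuous_on A (\<lambda>y. exp (\<i> * of_real \<nu> * Complex x y))"
    unfolding Complex_eq by (intro continuous_intros)
qed (use exp_halves_nonzero[OF assms] in blast)

definition vert_integral :: "real \<Rightarrow> real \<Rightarrow> real \<Rightarrow> complex" where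
  "vert_integral \<nu> x Y = integral {0..Y} (\<lambda>y. kern \<nu> (Complex x y))"

text \<open>The Laplace representation of \<open>exp (\<i> * c * x) / c\<close>, cut at height
  \<open>Y\<close>: moving up by \<open>y\<close> only multiplies the exponential by
  \<open>exp (- c * y)\<close>.\<close>

lemma has_integral_exp_vertical:
  assumes "c > 0" "Y \<ge> 0"
  shows "((\<lambda>y. exp (\<i> * of_real c * Complex x y)) has_integral
     exp (\<i> * of_real (c * x)) * of_real ((1 - exp (- c * Y)) / c)) {0..Y}"
proof -
  have "((\<lambda>y. exp (\<i> * of_real c * Complex x y)) has_integral
     - exp (\<i> * of_real c * Complex x Y) / of_real c - (- exp (\<i> * of_real c * Complex x 0) / of_real c)) {0..Y}"
  proof (rule fundamental_theorem_of_calculus[OF assms(2)])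
    fix y
    have "((\<lambda>w. - exp (\<i> * of_real c * (of_real x + \<i> * w)) / of_real c) has_field_derivative
       exp (\<i> * of_real c * (of_real x + \<i> * of_real y))) (at (of_real y))"
      using assms by (auto intro!: derivative_eq_intros simp: field_simps)
    from has_vector_derivative_real_field[OF this]
    show "((\<lambda>y. - exp (\<i> * of_real c * Complex x y) / of_real c) has_vector_derivative
       exp (\<i> * of_real c * Complex x y)) (at y within {0..Y})"
      unfolding Complex_eq by simp
  qed
  moreover have "exp (\<i> * of_real c * Complex x y) = exp (\<i> * of_real (c * x)) * of_real (exp (- c * y))" for y
    unfolding exp_of_real[symmetric] exp_add[symmetric]
    by (rule arg_cong[of _ _ exp]) (simp add: complex_eq_iff)
  ultimately show ?thesis
    using assms by (simp add: field_simps)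
qed

text \<open>Controls the remainder of the geometric series after \<open>N\<close> terms; integrating
  this bound over \<open>y\<close> gives O(1/N).\<close>

lemma norm_kern_mult_exp_le:
  assumes "0 < x" "x < 2 * pi" "\<nu> \<ge> 0" "y \<ge> 0"
  shows "norm (kern \<nu> (Complex x y) * exp (\<i> * Complex x y * of_nat N)) \<le> exp (- real N * y) / (2 * sin (x / 2))"
proof -
  have s: "sin (x / 2) > 0" using assms by (intro sin_gt_zero) auto
  then have "sin (x / 2) \<le> sqrt ((sin (x / 2))\<^sup>2 + (sinh (y / 2))\<^sup>2)"
    by (intro real_le_rsqrt) simp
  then have "exp (- \<nu> * y) / (2 * sqrt ((sin (x / 2))\<^sup>2 + (sinh (y / 2))\<^sup>2)) \<le> 1 / (2 * sin (x / 2))"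
    using s assms by (intro frac_le) auto
  then have "norm (kern \<nu> (Complex x y)) * exp (- real N * y) \<le> 1 / (2 * sin (x / 2)) * exp (- real N * y)"
    unfolding norm_kern by (intro mult_right_mono) auto
  moreover have "norm (exp (\<i> * Complex x y * of_nat N)) = exp (- real N * y)"
    by (simp add: mult.commute)
  ultimately show ?thesis by (simp only: norm_mult times_divide_eq_left mult_1_left)
qed

text \<open>Termwise integration of the finite geometric sum leaves two errors: \<open>U\<close>
  from cutting each Laplace integral at \<open>Y\<close>, and \<open>R\<close> from the remainder of
  the geometric series.\<close>

lemma partial_sum_approx:
  assumes x: "0 < x" "x < 2 * pi" and "\<nu> \<ge> 0" "Y \<ge> 1" "N > 0"
  shows "norm ((\<Sum>n<N. exp (\<i> * of_real ((real n + 1/2 + \<nu>) * x)) / of_real (real n + 1/2 + \<nu>)) - vert_integral \<nu> x Y)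
     \<le> 1 / (2 * sin (x / 2)) / real N + 4 * exp (- Y / 2)"
proof -
  define c where "c = (\<lambda>n. real n + 1/2 + \<nu>)"
  define e where "e = (\<lambda>n. exp (\<i> * of_real (c n * x)))"
  have c: "c n \<ge> real n + 1/2" "c n > 0" for n using assms by (auto simp: c_def)
  have s: "sin (x / 2) > 0" using x by (intro sin_gt_zero) auto
  define R where "R = integral {0..Y} (\<lambda>y. kern \<nu> (Complex x y) * exp (\<i> * Complex x y * of_nat N))"
  have int: "(\<lambda>y. kern \<nu> (Complex x y)) integrable_on {0..Y}"
    using continuous_on_kern[OF x] by (intro integrable_continuous_real)
  have intR: "(\<lambda>y. kern \<nu> (Complex x y) * exp (\<i> * Complex x y * of_nat N)) integrable_on {0..Y}"
    unfolding Complex_eq using continuous_on_kern[OF x, unfolded Complex_eq]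
    by (intro integrable_continuous_real continuous_intros)
  have "((\<lambda>y. \<Sum>n<N. exp (\<i> * of_real (c n) * Complex x y)) has_integral
      (\<Sum>n<N. e n * of_real ((1 - exp (- c n * Y)) / c n))) {0..Y}"
    unfolding e_def using c assms by (intro has_integral_sum has_integral_exp_vertical) auto
  also have "(\<lambda>y. \<Sum>n<N. exp (\<i> * of_real (c n) * Complex x y)) =
     (\<lambda>y. kern \<nu> (Complex x y) - kern \<nu> (Complex x y) * exp (\<i> * Complex x y * of_nat N))"
    unfolding c_def sum_exp_eq_kern[OF exp_halves_nonzero[OF x]] by (simp add: right_diff_distrib)
  finally have "(\<Sum>n<N. e n * of_real ((1 - exp (- c n * Y)) / c n)) = vert_integral \<nu> x Y - R"
    unfolding vert_integral_def R_def using integral_diff[OF int intR] by (simp only: integral_unique)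
  moreover define T U where "T = (\<Sum>n<N. e n / of_real (c n))"
    and "U = (\<Sum>n<N. e n * of_real (exp (- c n * Y) / c n))"
  have "(\<Sum>n<N. e n * of_real ((1 - exp (- c n * Y)) / c n)) = T - U"
    unfolding T_def U_def sum_subtractf[symmetric] by (simp add: diff_divide_distrib right_diff_distrib)
  ultimately have "T - U = vert_integral \<nu> x Y - R" by (simp only:)
  then have eq: "T - vert_integral \<nu> x Y = U - R" by (simp add: algebra_simps)
  \<comment> \<open>The constant 4 is 2 * 2: one factor from \<open>c n\<close> \<ge> 1/2, the other
    from a geometric series whose ratio \<open>exp (- Y)\<close> is at most 1/2.\<close>
  have "norm U \<le> (\<Sum>n<N. 2 * exp (- Y / 2) * exp (- Y) ^ n)"
    unfolding U_def
  proof (rule sum_norm_le)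
    fix n
    have "exp (- c n * Y) / c n \<le> exp (- Y / 2 - real n * Y) / (1 / 2)"
    proof (rule frac_le)
      have "(real n + 1 / 2) * Y \<le> c n * Y" using \<open>Y \<ge> 1\<close> c[of n] by (intro mult_right_mono) auto
      then show "exp (- c n * Y) \<le> exp (- Y / 2 - real n * Y)" by (simp add: algebra_simps)
    qed (use c[of n] in auto)
    also have "exp (- Y / 2 - real n * Y) = exp (- Y / 2) * exp (- Y) ^ n"
      unfolding exp_of_nat_mult[symmetric] exp_add[symmetric] by (simp add: algebra_simps)
    finally show "norm (e n * of_real (exp (- c n * Y) / c n)) \<le> 2 * exp (- Y / 2) * exp (- Y) ^ n"
      using c[of n] unfolding norm_mult norm_of_real e_def by simp
  qed
  also have "\<dots> \<le> 2 * exp (- Y / 2) * 2"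
  proof -
    have "exp Y \<ge> 2" using exp_ge_add_one_self[of Y] assms by linarith
    then have q: "exp (- Y) \<le> 1 / 2" by (simp add: exp_minus field_simps)
    have "(\<Sum>n<N. exp (- Y) ^ n) \<le> (\<Sum>n<N. (1 / 2) ^ n)"
      using q by (intro sum_mono power_mono) auto
    also have "\<dots> \<le> 2" by (simp add: sum_gp_strict)
    finally show ?thesis unfolding sum_distrib_left[symmetric] by (intro mult_left_mono) auto
  qed
  finally have "norm U \<le> 4 * exp (- Y / 2)" by simp
  moreover have "norm R \<le> 1 / (2 * sin (x / 2)) / real N"
  proof -
    have F: "((\<lambda>y. exp (- real N * y) / (2 * sin (x / 2))) has_integral
       - exp (- real N * Y) / (2 * sin (x / 2) * N) - (- exp (- real N * 0) / (2 * sin (x / 2) * N))) {0..Y}"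
      using assms s
      by (intro fundamental_theorem_of_calculus)
         (auto intro!: derivative_eq_intros simp: has_real_derivative_iff_has_vector_derivative[symmetric])
    have "norm R \<le> integral {0..Y} (\<lambda>y. exp (- real N * y) / (2 * sin (x / 2)))"
      unfolding R_def
      using intR F norm_kern_mult_exp_le[OF x \<open>\<nu> \<ge> 0\<close>]
      by (intro integral_norm_bound_integral) (auto simp: has_integral_integrable)
    also have "\<dots> = 1 / (2 * sin (x / 2) * N) - exp (- real N * Y) / (2 * sin (x / 2) * N)"
      using integral_unique[OF F] by simp
    also have "\<dots> \<le> 1 / (2 * sin (x / 2) * N)" using s by simp
    finally show ?thesis by simp
  qed
  ultimately show ?thesis
    using norm_triangle_ineq4[of U R] unfolding eq[symmetric] T_def e_def c_def by linarith
qed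

text \<open>Convergence of the series is itself a consequence of the approximation: its partial sums
  are eventually close to one fixed vertical integral, so they are Cauchy.\<close>

lemma vert_integral_limit:
  assumes x: "0 < x" "x < 2 * pi" and "\<nu> \<ge> 0"
  obtains G where "(\<lambda>n. exp (\<i> * of_real ((real n + 1/2 + \<nu>) * x)) / of_real (real n + 1/2 + \<nu>)) sums G"
    and "\<And>Y. Y \<ge> 1 \<Longrightarrow> norm (G - vert_integral \<nu> x Y) \<le> 4 * exp (- Y / 2)"
proof -
  define S where "S = (\<lambda>N. \<Sum>n<N. exp (\<i> * of_real ((real n + 1/2 + \<nu>) * x)) / of_real (real n + 1/2 + \<nu>))"
  define C where "C = 1 / (2 * sin (x / 2))"
  have s: "sin (x / 2) > 0" using x by (intro sin_gt_zero) auto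
  have S: "norm (S N - vert_integral \<nu> x Y) \<le> C / real N + 4 * exp (- Y / 2)" if "Y \<ge> 1" "N > 0" for N Y
    unfolding S_def C_def using partial_sum_approx[OF x \<open>\<nu> \<ge> 0\<close> that] .
  \<comment> \<open>\<open>Y\<close> is fixed first, then \<open>N\<close> is taken large, so that
    all later partial sums lie within \<open>\<epsilon> / 2\<close> of the same integral.\<close>
  have "Cauchy S"
  proof (rule metric_CauchyI)
    fix \<epsilon> :: real assume "\<epsilon> > 0"
    have "((\<lambda>Y::real. 4 * exp (- Y / 2)) \<longlongrightarrow> 0) at_top" by real_asymp
    then have "\<forall>\<^sub>F Y in at_top. 4 * exp (- Y / 2) < \<epsilon> / 4"
      using \<open>\<epsilon> > 0\<close> by (intro order_tendstoD(2)[of _ 0]) auto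
    then have "\<forall>\<^sub>F Y::real in at_top. Y \<ge> 1 \<and> 4 * exp (- Y / 2) < \<epsilon> / 4"
      using eventually_ge_at_top by (intro eventually_conj)
    then obtain Y :: real where Y: "Y \<ge> 1" "4 * exp (- Y / 2) < \<epsilon> / 4"
      using eventually_happens by fastforce
    have "(\<lambda>N. C / real N) \<longlonglongrightarrow> 0" by real_asymp
    then have "\<forall>\<^sub>F N in sequentially. C / real N < \<epsilon> / 4"
      using \<open>\<epsilon> > 0\<close> by (intro order_tendstoD(2)[of _ 0]) auto
    then have "\<forall>\<^sub>F N in sequentially. N > 0 \<and> C / real N < \<epsilon> / 4"
      using eventually_gt_at_top by (intro eventually_conj)
    then obtain M where M: "\<And>N. N \<ge> M \<Longrightarrow> N > 0 \<and> C / real N < \<epsilon> / 4"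
      by (auto simp: eventually_sequentially)
    have "norm (S N - vert_integral \<nu> x Y) < \<epsilon> / 2" if "N \<ge> M" for N
      using S[OF Y(1), of N] M[OF that] Y(2) by linarith
    then show "\<exists>M. \<forall>m\<ge>M. \<forall>n\<ge>M. dist (S m) (S n) < \<epsilon>"
      by (metis dist_norm dist_triangle_half_l)
  qed
  then obtain G where G: "S \<longlonglongrightarrow> G" using Cauchy_convergent convergent_def by blast
  show ?thesis
  proof
    show "(\<lambda>n. exp (\<i> * of_real ((real n + 1/2 + \<nu>) * x)) / of_real (real n + 1/2 + \<nu>)) sums G"
      using G unfolding S_def sums_def .
    fix Y :: real assume "Y \<ge> 1"
    have "(\<lambda>N. norm (S N - vert_integral \<nu> x Y)) \<longlonglongrightarrow> norm (G - vert_integral \<nu> x Y)"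
      using G by (intro tendsto_intros)
    moreover have "(\<lambda>N. C / real N + 4 * exp (- Y / 2)) \<longlonglongrightarrow> 4 * exp (- Y / 2)" by real_asymp
    ultimately show "norm (G - vert_integral \<nu> x Y) \<le> 4 * exp (- Y / 2)"
    proof (rule LIMSEQ_le)
      show "\<exists>N. \<forall>n\<ge>N. norm (S n - vert_integral \<nu> x Y) \<le> C / real n + 4 * exp (- Y / 2)"
        using S[OF \<open>Y \<ge> 1\<close>] by (intro exI[of _ 1]) auto
    qed
  qed
qed

text \<open>The phase \<open>exp (\<i> * x * \<mu>)\<close> turns the frequency k of the series into
  k + \<mu>, which equals \<open>n + 1/2 + \<nu>\<close> for k = n + 1. Hence \<open>G\<close> is
  the product whose imaginary part defines \<open>ImL\<close>.\<close>

lemma ImL_approx: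
  assumes "0 < x" "x \<le> pi" "\<nu> \<ge> 0" "Y \<ge> 1"
  shows "\<bar>ImL x (\<nu> - 1/2) - Im (vert_integral \<nu> x Y)\<bar> \<le> 4 * exp (- Y / 2)"
proof -
  have x: "0 < x" "x < 2 * pi" using assms pi_gt_zero by linarith+
  define \<mu> where "\<mu> = \<nu> - 1/2"
  obtain G where G: "(\<lambda>n. exp (\<i> * of_real ((real n + 1/2 + \<nu>) * x)) / of_real (real n + 1/2 + \<nu>)) sums G"
    and le: "\<And>Y. Y \<ge> 1 \<Longrightarrow> norm (G - vert_integral \<nu> x Y) \<le> 4 * exp (- Y / 2)"
    using vert_integral_limit[OF x \<open>\<nu> \<ge> 0\<close>] by blast
  have "(\<lambda>n. exp (- \<i> * of_real (x * \<mu>)) * (exp (\<i> * of_real ((real n + 1/2 + \<nu>) * x)) / of_real (real n + 1/2 + \<nu>)))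
     sums (exp (- \<i> * of_real (x * \<mu>)) * G)"
    using G by (rule sums_mult)
  also have "(\<lambda>n. exp (- \<i> * of_real (x * \<mu>)) * (exp (\<i> * of_real ((real n + 1/2 + \<nu>) * x)) / of_real (real n + 1/2 + \<nu>)))
     = (\<lambda>n. exp (\<i> * of_real (real (Suc n) * x)) / of_real (real (Suc n) + \<mu>))"
  proof
    fix n
    have "exp (- \<i> * of_real (x * \<mu>)) * exp (\<i> * of_real ((real n + 1/2 + \<nu>) * x)) = exp (\<i> * of_real (real (Suc n) * x))"
      unfolding exp_add[symmetric]
      by (rule arg_cong[of _ _ exp]) (simp add: complex_eq_iff \<mu>_def algebra_simps)
    moreover have "real n + 1/2 + \<nu> = real (Suc n) + \<mu>" by (simp add: \<mu>_def)
    ultimately show "exp (- \<i> * of_real (x * \<mu>)) * (exp (\<i> * of_real ((real n + 1/2 + \<nu>) * x)) / of_real (real n + 1/2 + \<nu>))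
     = exp (\<i> * of_real (real (Suc n) * x)) / of_real (real (Suc n) + \<mu>)"
      by (metis times_divide_eq_right)
  qed
  finally have "L x \<mu> = exp (- \<i> * of_real (x * \<mu>)) * G" unfolding L_def by (rule sums_unique[symmetric])
  then have "exp (\<i> * of_real (x * \<mu>)) * L x \<mu> = (exp (\<i> * of_real (x * \<mu>)) * exp (- \<i> * of_real (x * \<mu>))) * G"
    by (simp only: mult.assoc)
  also have "\<dots> = G" unfolding exp_add[symmetric] by simp
  finally have "ImL x \<mu> = Im G" using x by (simp add: ImL_def)
  then have "\<bar>ImL x \<mu> - Im (vert_integral \<nu> x Y)\<bar> \<le> norm (G - vert_integral \<nu> x Y)"
    using abs_Im_le_cmod[of "G - vert_integral \<nu> x Y"] by simp
  then show ?thesis using le[OF \<open>Y \<ge> 1\<close>] unfolding \<mu>_def by linarith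
qed

section \<open>Variation in the horizontal direction\<close>

text \<open>The complex derivative, written as \<open>kern\<close> times its logarithmic
  derivative.\<close>

definition kern_deriv :: "real \<Rightarrow> complex \<Rightarrow> complex" where
  "kern_deriv \<nu> z = \<i> * kern \<nu> z *
     (of_real \<nu> + (exp (- \<i> * z / 2) + exp (\<i> * z / 2)) / (2 * (exp (- \<i> * z / 2) - exp (\<i> * z / 2))))"

lemma kern_has_derivative:
  assumes "exp (- \<i> * z / 2) - exp (\<i> * z / 2) \<noteq> 0"
  shows "(kern \<nu> has_field_derivative kern_deriv \<nu> z) (at z)"
proof -
  define p q e where "p = exp (- \<i> * z / 2)" and "q = exp (\<i> * z / 2)" and "e = exp (\<i> * of_real \<nu> * z)"
  have d: "p - q \<noteq> 0" using assms by (simp add: p_def q_def)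
  have "(kern \<nu> has_field_derivative
      (\<i> * of_real \<nu> * e * (p - q) - e * (- \<i> / 2 * p - \<i> / 2 * q)) / (p - q)\<^sup>2) (at z)"
    unfolding kern_def[abs_def] p_def q_def e_def power2_eq_square
    using assms by (auto intro!: derivative_eq_intros simp: mult.commute)
  moreover have "kern_deriv \<nu> z = (\<i> * of_real \<nu> * e * (p - q) - e * (- \<i> / 2 * p - \<i> / 2 * q)) / (p - q)\<^sup>2"
    unfolding kern_deriv_def kern_def p_def[symmetric] q_def[symmetric] e_def[symmetric]
    using d by (simp add: divide_simps) (simp add: algebra_simps power2_eq_square)
  ultimately show ?thesis by simp
qed

text \<open>Both directional derivatives come from one complex derivative; their ratio
  \<open>\<i>\<close> is the Cauchy-Riemann relation used in the next computation.\<close>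

lemma kern_has_vector_derivatives:
  assumes "0 < x" "x < 2 * pi"
  shows "((\<lambda>x. kern \<nu> (Complex x y)) has_vector_derivative kern_deriv \<nu> (Complex x y)) (at x within A)"
    and "((\<lambda>y. kern \<nu> (Complex x y)) has_vector_derivative \<i> * kern_deriv \<nu> (Complex x y)) (at y within A)"
proof -
  have D: "(kern \<nu> has_field_derivative kern_deriv \<nu> (Complex x y)) (at (Complex x y))"
    using kern_has_derivative exp_halves_nonzero[OF assms] by blast
  have "((\<lambda>w. kern \<nu> (w + \<i> * of_real y)) has_field_derivative kern_deriv \<nu> (Complex x y) * 1) (at (of_real x))"
    using D unfolding Complex_eq by (intro DERIV_chain2[where f = "kern \<nu>"]) (auto intro!: derivative_eq_intros)
  from has_vector_derivative_real_field[OF this]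
  show "((\<lambda>x. kern \<nu> (Complex x y)) has_vector_derivative kern_deriv \<nu> (Complex x y)) (at x within A)"
    unfolding Complex_eq by simp
  have "((\<lambda>w. kern \<nu> (of_real x + \<i> * w)) has_field_derivative kern_deriv \<nu> (Complex x y) * \<i>) (at (of_real y))"
    using D unfolding Complex_eq by (intro DERIV_chain2[where f = "kern \<nu>"]) (auto intro!: derivative_eq_intros)
  from has_vector_derivative_real_field[OF this]
  show "((\<lambda>y. kern \<nu> (Complex x y)) has_vector_derivative \<i> * kern_deriv \<nu> (Complex x y)) (at y within A)"
    unfolding Complex_eq by (simp add: mult.commute)
qed

lemma continuous_on_kern_deriv:
  "continuous_on ({0<..<2 * pi} \<times> B) (\<lambda>(x, y). kern_deriv \<nu> (Complex x y))"
proof -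
  have nz: "exp (- \<i> * Complex (fst w) (snd w) / 2) - exp (\<i> * Complex (fst w) (snd w) / 2) \<noteq> 0"
    if "w \<in> {0<..<2 * pi} \<times> B" for w
    using that by (intro exp_halves_nonzero) auto
  show ?thesis
    unfolding kern_deriv_def kern_def case_prod_beta
    using nz unfolding Complex_eq
    by (intro continuous_intros) auto
qed

text \<open>Differentiation under the integral sign gives the x-derivative of the kernel, which is
  \<open>- \<i>\<close> times its y-derivative; the integral then reduces to its two endpoint
  values.\<close>

lemma vert_integral_has_vector_derivative:
  assumes "0 < x" "x < 2 * pi" "Y \<ge> 0"
  shows "((\<lambda>x. vert_integral \<nu> x Y) has_vector_derivative - \<i> * (kern \<nu> (Complex x Y) - kern \<nu> (Complex x 0))) (at x)"
proof -
  let ?U = "{0<..<2 * pi}"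
  have "((\<lambda>x. integral (cbox 0 Y) (\<lambda>y. kern \<nu> (Complex x y))) has_vector_derivative
      integral (cbox 0 Y) (\<lambda>y. kern_deriv \<nu> (Complex x y))) (at x within ?U)"
  proof (rule leibniz_rule_vector_derivative)
    fix x y assume "x \<in> ?U"
    then show "((\<lambda>x. kern \<nu> (Complex x y)) has_vector_derivative kern_deriv \<nu> (Complex x y)) (at x within ?U)"
      by (intro kern_has_vector_derivatives) auto
  next
    fix x assume "x \<in> ?U"
    then show "(\<lambda>y. kern \<nu> (Complex x y)) integrable_on cbox 0 Y"
      unfolding cbox_interval by (intro integrable_continuous_real continuous_on_kern) auto
  qed (use assms continuous_on_kern_deriv in auto)
  moreover have "at x within ?U = at x"
    using assms by (intro at_within_open) auto
  moreover have "((\<lambda>y. \<i> * kern_deriv \<nu> (Complex x y)) has_integral (kern \<nu> (Complex x Y) - kern \<nu> (Complex x 0))) {0..Y}"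
    using assms by (intro fundamental_theorem_of_calculus kern_has_vector_derivatives) auto
  then have "((\<lambda>y. - \<i> * (\<i> * kern_deriv \<nu> (Complex x y))) has_integral - \<i> * (kern \<nu> (Complex x Y) - kern \<nu> (Complex x 0))) {0..Y}"
    by (rule has_integral_mult_right)
  then have "integral {0..Y} (\<lambda>y. kern_deriv \<nu> (Complex x y)) = - \<i> * (kern \<nu> (Complex x Y) - kern \<nu> (Complex x 0))"
    by (intro integral_unique) (simp add: mult.assoc[symmetric])
  ultimately show ?thesis unfolding vert_integral_def cbox_interval by simp
qed

text \<open>A comparison principle for increments. For the truncated integral the derivative equals
  \<open>- sin (\<nu> * t) / (2 * sin (t / 2))\<close> up to a boundary term at height
  \<open>Y\<close>; that term and the truncation errors vanish as \<open>Y\<close> grows.\<close>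

lemma ImL_diff_le:
  assumes x: "0 < x1" "x1 \<le> x2" "x2 \<le> pi" and "\<nu> \<ge> 0"
    and A: "\<And>t. x1 \<le> t \<Longrightarrow> t \<le> x2 \<Longrightarrow> (A has_real_derivative A' t) (at t)"
    and A': "\<And>t. x1 \<le> t \<Longrightarrow> t \<le> x2 \<Longrightarrow> A' t \<ge> - sin (\<nu> * t) / (2 * sin (t / 2))"
  shows "ImL x2 (\<nu> - 1/2) - ImL x1 (\<nu> - 1/2) \<le> A x2 - A x1"
proof -
  have bound: "ImL x2 (\<nu> - 1/2) - ImL x1 (\<nu> - 1/2) \<le>
      A x2 - A x1 + (x2 - x1) / (2 * sinh (Y / 2)) + 8 * exp (- Y / 2)" if "Y \<ge> 1" for Y
  proof -
    define \<epsilon> where "\<epsilon> = 1 / (2 * sinh (Y / 2))"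
    have sh: "sinh (Y / 2) > 0" using that by simp
    \<comment> \<open>The linear term absorbs the boundary term at height \<open>Y\<close>, whose
      size is at most \<open>\<epsilon>\<close>, and makes \<open>h\<close> nondecreasing.\<close>
    define h where "h = (\<lambda>t. A t - Im (vert_integral \<nu> t Y) + \<epsilon> * t)"
    have "h x1 \<le> h x2"
    proof (rule DERIV_nonneg_imp_nondecreasing[OF \<open>x1 \<le> x2\<close>])
      fix t assume t: "x1 \<le> t" "t \<le> x2"
      then have t': "0 < t" "t < 2 * pi" using x pi_gt_zero by linarith+
      have s: "sin (t / 2) > 0" using t' by (intro sin_gt_zero) auto
      have "((\<lambda>x. Im (vert_integral \<nu> x Y)) has_vector_derivative
          Im (- \<i> * (kern \<nu> (Complex t Y) - kern \<nu> (Complex t 0)))) (at t)"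
        using vert_integral_has_vector_derivative[OF t', of Y] that
        by (intro bounded_linear.has_vector_derivative[OF bounded_linear_Im]) auto
      then have "((\<lambda>x. Im (vert_integral \<nu> x Y)) has_real_derivative
          Re (kern \<nu> (Complex t 0)) - Re (kern \<nu> (Complex t Y))) (at t)"
        by (simp add: has_real_derivative_iff_has_vector_derivative)
      from DERIV_add[OF DERIV_diff[OF A[OF t] this] DERIV_cmult_Id[of \<epsilon>]] have "(h has_real_derivative
          A' t - (Re (kern \<nu> (Complex t 0)) - Re (kern \<nu> (Complex t Y))) + \<epsilon>) (at t)"
        unfolding h_def .
      moreover have "Re (kern \<nu> (Complex t 0)) = - sin (\<nu> * t) / (2 * sin (t / 2))"
        unfolding kern_eq using s by (simp add: power2_eq_square)
      moreover have "\<bar>Re (kern \<nu> (Complex t Y))\<bar> \<le> \<epsilon>"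
      proof -
        have "sinh (Y / 2) \<le> sqrt ((sin (t / 2))\<^sup>2 + (sinh (Y / 2))\<^sup>2)"
          by (intro real_le_rsqrt) simp
        then have "norm (kern \<nu> (Complex t Y)) \<le> \<epsilon>"
          unfolding norm_kern \<epsilon>_def using that sh \<open>\<nu> \<ge> 0\<close> by (intro frac_le) auto
        then show ?thesis using abs_Re_le_cmod order_trans by blast
      qed
      ultimately show "\<exists>y. (h has_real_derivative y) (at t) \<and> 0 \<le> y"
        using A'[OF t] by (intro exI conjI) auto
    qed
    then have "Im (vert_integral \<nu> x2 Y) - Im (vert_integral \<nu> x1 Y) \<le> A x2 - A x1 + \<epsilon> * (x2 - x1)"
      unfolding h_def by (simp add: algebra_simps)
    moreover have "\<bar>ImL x1 (\<nu> - 1/2) - Im (vert_integral \<nu> x1 Y)\<bar> \<le> 4 * exp (- Y / 2)"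
      "\<bar>ImL x2 (\<nu> - 1/2) - Im (vert_integral \<nu> x2 Y)\<bar> \<le> 4 * exp (- Y / 2)"
      using assms that by (intro ImL_approx; linarith)+
    moreover have "\<epsilon> * (x2 - x1) = (x2 - x1) / (2 * sinh (Y / 2))" by (simp add: \<epsilon>_def)
    ultimately show ?thesis by linarith
  qed
  have "((\<lambda>Y. A x2 - A x1 + (x2 - x1) / (2 * sinh (Y / 2)) + 8 * exp (- Y / 2)) \<longlongrightarrow> A x2 - A x1) at_top"
    unfolding sinh_field_def by real_asymp
  then show ?thesis
    by (rule tendsto_lowerbound[OF _ eventually_mono[OF eventually_ge_at_top bound]]) simp_all
qed

section \<open>Behaviour at the origin\<close>

lemma Im_vert_integral:
  assumes "0 < x" "x < 2 * pi"
  shows "Im (vert_integral \<nu> x Y) = integral {0..Y} (\<lambda>y. Im (kern \<nu> (Complex x y)))"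
    and "(\<lambda>y. Im (kern \<nu> (Complex x y))) integrable_on {0..Y}"
proof -
  have int: "(\<lambda>y. kern \<nu> (Complex x y)) integrable_on {0..Y}"
    using continuous_on_kern[OF assms] by (intro integrable_continuous_real)
  from has_integral_linear[OF integrable_integral[OF this] bounded_linear_Im]
  have "((\<lambda>y. Im (kern \<nu> (Complex x y))) has_integral Im (vert_integral \<nu> x Y)) {0..Y}"
    by (simp add: vert_integral_def o_def)
  then show "Im (vert_integral \<nu> x Y) = integral {0..Y} (\<lambda>y. Im (kern \<nu> (Complex x y)))"
    and "(\<lambda>y. Im (kern \<nu> (Complex x y))) integrable_on {0..Y}"
    by (simp_all add: integral_unique has_integral_integrable)
qed

section \<open>Closed forms for the two pieces of the imaginary part\<close>

lemma has_integral_arctan_sinh: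
  fixes s Y :: real
  assumes "s > 0" "Y \<ge> 0"
  shows "((\<lambda>y. s * cosh (y / 2) / (2 * (s\<^sup>2 + (sinh (y / 2))\<^sup>2))) has_integral arctan (sinh (Y / 2) / s)) {0..Y}"
proof -
  have "((\<lambda>y. s * cosh (y / 2) / (2 * (s\<^sup>2 + (sinh (y / 2))\<^sup>2))) has_integral
      arctan (sinh (Y / 2) / s) - arctan (sinh (0 / 2) / s)) {0..Y}"
  proof (rule fundamental_theorem_of_calculus[OF assms(2)])
    fix y
    \<comment> \<open>The antiderivative is the one given by the substitution u =
      \<open>sinh (y / 2) / s\<close>.\<close>
    have "1 + (sinh (y / 2) / s)\<^sup>2 > 0" "s\<^sup>2 + (sinh (y / 2))\<^sup>2 > 0" using assms
      by (auto simp: add_pos_nonneg)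
    then have "inverse (1 + (sinh (y / 2) / s)\<^sup>2) * (cosh (y / 2) * (1 / 2) / s) = s * cosh (y / 2) / (2 * (s\<^sup>2 + (sinh (y / 2))\<^sup>2))"
      using assms by (simp add: field_simps power2_eq_square)
    moreover have "((\<lambda>y. arctan (sinh (y / 2) / s)) has_real_derivative
       inverse (1 + (sinh (y / 2) / s)\<^sup>2) * (cosh (y / 2) * (1 / 2) / s)) (at y within {0..Y})"
      using assms by (auto intro!: derivative_eq_intros)
    ultimately show "((\<lambda>y. arctan (sinh (y / 2) / s)) has_vector_derivative
       s * cosh (y / 2) / (2 * (s\<^sup>2 + (sinh (y / 2))\<^sup>2))) (at y within {0..Y})"
      by (simp add: has_real_derivative_iff_has_vector_derivative)
  qed
  then show ?thesis by simp
qed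

text \<open>The numerator \<open>sinh (y / 2) * cosh (y / 2)\<close> is the derivative of
  \<open>s\<^sup>2 + (sinh (y / 2))\<^sup>2\<close>, so the integrand is half a logarithmic
  derivative. Its growth as \<open>s\<close> tends to 0 is only logarithmic.\<close>

lemma has_integral_ln_sinh:
  fixes s Y :: real
  assumes "s > 0" "Y \<ge> 0"
  shows "((\<lambda>y. sinh (y / 2) * cosh (y / 2) / (2 * (s\<^sup>2 + (sinh (y / 2))\<^sup>2))) has_integral
     ln (s\<^sup>2 + (sinh (Y / 2))\<^sup>2) / 2 - ln (s\<^sup>2) / 2) {0..Y}"
proof -
  have "((\<lambda>y. sinh (y / 2) * cosh (y / 2) / (2 * (s\<^sup>2 + (sinh (y / 2))\<^sup>2))) has_integral
     ln (s\<^sup>2 + (sinh (Y / 2))\<^sup>2) / 2 - ln (s\<^sup>2 + (sinh (0 / 2))\<^sup>2) / 2) {0..Y}"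
  proof (rule fundamental_theorem_of_calculus[OF assms(2)])
    fix y
    have p: "s\<^sup>2 + (sinh (y / 2))\<^sup>2 > 0" using assms by (auto simp: add_pos_nonneg)
    have "((\<lambda>y. ln (s\<^sup>2 + (sinh (y / 2))\<^sup>2) / 2) has_real_derivative
       sinh (y / 2) * cosh (y / 2) / (2 * (s\<^sup>2 + (sinh (y / 2))\<^sup>2))) (at y within {0..Y})"
      using p by (auto intro!: derivative_eq_intros simp: field_simps)
    then show "((\<lambda>y. ln (s\<^sup>2 + (sinh (y / 2))\<^sup>2) / 2) has_vector_derivative
       sinh (y / 2) * cosh (y / 2) / (2 * (s\<^sup>2 + (sinh (y / 2))\<^sup>2))) (at y within {0..Y})"
      by (simp add: has_real_derivative_iff_has_vector_derivative)
  qed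
  then show ?thesis by simp
qed

lemma Im_kern:
  "Im (kern \<nu> (Complex x y)) = exp (- \<nu> * y) *
    (sin (\<nu> * x) * cos (x / 2) * sinh (y / 2) + cos (\<nu> * x) * sin (x / 2) * cosh (y / 2)) /
    (2 * ((sin (x / 2))\<^sup>2 + (sinh (y / 2))\<^sup>2))"
  unfolding kern_eq by (simp add: mult.assoc)

text \<open>For \<open>\<nu> = 0\<close> only the arctan piece of the integrand survives, and its
  closed form tends to \<pi>/2 with growing height.\<close>

lemma ImL_minus_half:
  assumes "0 < x" "x \<le> pi"
  shows "ImL x (- 1/2) = pi / 2"
proof -
  have x: "0 < x" "x < 2 * pi" using assms pi_gt_zero by linarith+
  have s: "sin (x / 2) > 0" using x by (intro sin_gt_zero) auto
  have eq: "Im (vert_integral 0 x Y) = arctan (sinh (Y / 2) / sin (x / 2))" if "Y \<ge> 1" for Y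
    unfolding Im_vert_integral[OF x] Im_kern using has_integral_arctan_sinh[OF s, of Y] that
    by (intro integral_unique) simp
  have le: "\<bar>ImL x (- 1/2) - arctan (sinh (Y / 2) / sin (x / 2))\<bar> \<le> 4 * exp (- Y / 2)" if "Y \<ge> 1" for Y
    using ImL_approx[OF assms, of 0 Y] that eq[OF that] by simp
  have "((\<lambda>Y. ImL x (- 1/2) - arctan (sinh (Y / 2) / sin (x / 2))) \<longlongrightarrow> 0) at_top"
  proof (rule Lim_null_comparison)
    show "\<forall>\<^sub>F Y in at_top. norm (ImL x (- 1/2) - arctan (sinh (Y / 2) / sin (x / 2))) \<le> 4 * exp (- Y / 2)"
      using eventually_ge_at_top[of "1::real"] by eventually_elim (use le in auto)
    show "((\<lambda>Y::real. 4 * exp (- Y / 2)) \<longlongrightarrow> 0) at_top" by real_asymp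
  qed
  moreover have "((\<lambda>Y. c - arctan (sinh (Y / 2) / s)) \<longlongrightarrow> c - pi / 2) at_top" if "s > 0" for c s :: real
    unfolding sinh_field_def using that by real_asymp
  from this[OF s] have "((\<lambda>Y. ImL x (- 1/2) - arctan (sinh (Y / 2) / sin (x / 2))) \<longlongrightarrow> ImL x (- 1/2) - pi / 2) at_top" .
  ultimately show ?thesis using tendsto_unique[OF trivial_limit_at_top_linorder] by fastforce
qed

text \<open>The integral is cut at height \<open>1 / sqrt x\<close> for the upper bound, and its part above \<open>sqrt x\<close> is dropped for the
  lower bound; these choices make both bounds tend to \<open>\<pi>/2\<close>.\<close>

lemma ImL_near_zero:
  assumes "0 < x" "x \<le> 1" "\<nu> \<ge> 0" "\<nu> * x \<le> pi / 2"
  shows "ImL x (\<nu> - 1/2) \<le> pi / 2 +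
      sin (\<nu> * x) * (ln (1 + exp (1 / sqrt x)) / 2 - ln ((sin (x / 2))\<^sup>2) / 2) +
      4 * exp (- (1 / sqrt x) / 2)"
    and "ImL x (\<nu> - 1/2) \<ge> cos (\<nu> * x) * exp (- \<nu> * sqrt x) * arctan (sinh (sqrt x / 2) / sin (x / 2)) -
      4 * exp (- (1 / sqrt x) / 2)"
proof -
  have x: "0 < x" "x < 2 * pi" "x \<le> pi" using assms pi_gt3 by linarith+
  have s: "sin (x / 2) > 0" using x by (intro sin_gt_zero) auto
  have c: "cos (x / 2) \<ge> 0" using x by (intro cos_ge_zero) auto
  have \<nu>x: "0 \<le> \<nu> * x" "\<nu> * x \<le> pi" "- (pi / 2) \<le> \<nu> * x"
    using assms pi_gt_zero mult_nonneg_nonneg[of \<nu> x] by linarith+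
  have sn: "sin (\<nu> * x) \<ge> 0" using \<nu>x by (intro sin_ge_zero)
  have cn: "cos (\<nu> * x) \<ge> 0" using \<nu>x assms by (intro cos_ge_zero)
  define Y \<eta> where "Y = 1 / sqrt x" and "\<eta> = sqrt x"
  have Y: "Y \<ge> 1" "\<eta> \<le> Y" "\<eta> \<ge> 0" using assms by (auto simp: Y_def \<eta>_def field_simps)
  define D where "D = (\<lambda>y. 2 * ((sin (x / 2))\<^sup>2 + (sinh (y / 2))\<^sup>2))"
  have D: "D y > 0" for y using s by (simp add: D_def add_pos_nonneg)
  have K: "Im (kern \<nu> (Complex x y)) = exp (- \<nu> * y) *
    (sin (\<nu> * x) * cos (x / 2) * sinh (y / 2) + cos (\<nu> * x) * sin (x / 2) * cosh (y / 2)) / D y" for y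
    unfolding D_def by (rule Im_kern)
  have approx: "\<bar>ImL x (\<nu> - 1/2) - Im (vert_integral \<nu> x Y)\<bar> \<le> 4 * exp (- Y / 2)"
    using x assms Y by (intro ImL_approx) auto
  have at: "((\<lambda>y. sin (x / 2) * cosh (y / 2) / D y) has_integral arctan (sinh (Z / 2) / sin (x / 2))) {0..Z}"
    if "Z \<ge> 0" for Z unfolding D_def using has_integral_arctan_sinh[OF s that] .
  \<comment> \<open>The factors \<open>exp (- \<nu> * y)\<close> and \<open>cos (\<nu> * x)\<close>
    are bounded by 1, and \<open>cos (x / 2)\<close> \<le> 1 \<le> \<open>cosh (y / 2)\<close>
    supplies the factor needed for the logarithmic integral.\<close>
  have up: "Im (kern \<nu> (Complex x y)) \<le> sin (\<nu> * x) * (sinh (y / 2) * cosh (y / 2) / D y) + sin (x / 2) * cosh (y / 2) / D y"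
    if "y \<ge> 0" for y
  proof -
    have 1: "cosh (y / 2) \<ge> 1" by (rule cosh_real_ge_1)
    have sh: "sinh (y / 2) \<ge> 0" using that by simp
    have "sin (\<nu> * x) * cos (x / 2) * sinh (y / 2) \<le> sin (\<nu> * x) * (sinh (y / 2) * cosh (y / 2))"
      unfolding mult.assoc using sn sh 1 cos_le_one[of "x / 2"] 
      by (intro mult_left_mono) (metis mult.commute mult_left_mono order_trans)
    moreover have "cos (\<nu> * x) * sin (x / 2) * cosh (y / 2) \<le> 1 * (sin (x / 2) * cosh (y / 2))"
      unfolding mult.assoc using s 1 by (intro mult_right_mono) auto
    moreover have "0 \<le> sin (\<nu> * x) * cos (x / 2) * sinh (y / 2) + cos (\<nu> * x) * sin (x / 2) * cosh (y / 2)"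
      using sn c sh cn s by simp
    moreover have "exp (- \<nu> * y) \<le> 1" using assms that by simp
    ultimately have "exp (- \<nu> * y) * (sin (\<nu> * x) * cos (x / 2) * sinh (y / 2) + cos (\<nu> * x) * sin (x / 2) * cosh (y / 2))
      \<le> 1 * (sin (\<nu> * x) * (sinh (y / 2) * cosh (y / 2)) + sin (x / 2) * cosh (y / 2))"
      by (intro mult_mono) auto
    then show ?thesis
      unfolding K times_divide_eq_right add_divide_distrib[symmetric] mult_1_left
      using D[of y] by (intro divide_right_mono) auto
  qed
  have "Im (vert_integral \<nu> x Y) \<le> sin (\<nu> * x) * (ln ((sin (x / 2))\<^sup>2 + (sinh (Y / 2))\<^sup>2) / 2 - ln ((sin (x / 2))\<^sup>2) / 2)
     + arctan (sinh (Y / 2) / sin (x / 2))"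
    unfolding Im_vert_integral(1)[OF x(1,2)]
  proof (rule has_integral_le[OF integrable_integral[OF Im_vert_integral(2)[OF x(1,2)]]])
    show "((\<lambda>y. sin (\<nu> * x) * (sinh (y / 2) * cosh (y / 2) / D y) + sin (x / 2) * cosh (y / 2) / D y) has_integral
       sin (\<nu> * x) * (ln ((sin (x / 2))\<^sup>2 + (sinh (Y / 2))\<^sup>2) / 2 - ln ((sin (x / 2))\<^sup>2) / 2)
     + arctan (sinh (Y / 2) / sin (x / 2))) {0..Y}"
      unfolding D_def using Y s has_integral_ln_sinh[OF s, of Y] has_integral_arctan_sinh[OF s, of Y]
      by (intro has_integral_add has_integral_mult_right) auto
  qed (use up in auto)
  moreover have "arctan (sinh (Y / 2) / sin (x / 2)) \<le> pi / 2" using arctan_ubound less_imp_le by blast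
  moreover have "sin (\<nu> * x) * (ln ((sin (x / 2))\<^sup>2 + (sinh (Y / 2))\<^sup>2) / 2 - ln ((sin (x / 2))\<^sup>2) / 2) \<le>
      sin (\<nu> * x) * (ln (1 + exp Y) / 2 - ln ((sin (x / 2))\<^sup>2) / 2)"
  proof -
    have "(sinh (Y / 2))\<^sup>2 \<le> (exp (Y / 2))\<^sup>2"
      using Y by (intro power_mono) (auto simp: sinh_field_def field_simps)
    also have "\<dots> = exp Y" by (simp add: power2_eq_square flip: exp_add)
    finally have "(sin (x / 2))\<^sup>2 + (sinh (Y / 2))\<^sup>2 \<le> 1 + exp Y"
      using abs_square_le_1[of "sin (x / 2)"] by auto
    then show ?thesis
      using sn D[of Y] by (intro mult_left_mono diff_right_mono divide_right_mono ln_mono) (auto simp: D_def)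
  qed
  ultimately show "ImL x (\<nu> - 1/2) \<le> pi / 2 +
      sin (\<nu> * x) * (ln (1 + exp (1 / sqrt x)) / 2 - ln ((sin (x / 2))\<^sup>2) / 2) +
      4 * exp (- (1 / sqrt x) / 2)"
    using approx unfolding Y_def[symmetric] by linarith
  have low: "Im (kern \<nu> (Complex x y)) \<ge> exp (- \<nu> * y) * cos (\<nu> * x) * (sin (x / 2) * cosh (y / 2) / D y)"
    if "y \<ge> 0" for y
  proof -
    have "0 \<le> sin (\<nu> * x) * cos (x / 2) * sinh (y / 2)" using sn c that by simp
    then have "exp (- \<nu> * y) * (cos (\<nu> * x) * sin (x / 2) * cosh (y / 2)) \<le>
      exp (- \<nu> * y) * (sin (\<nu> * x) * cos (x / 2) * sinh (y / 2) + cos (\<nu> * x) * sin (x / 2) * cosh (y / 2))"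
      by (intro mult_left_mono) auto
    then show ?thesis
      unfolding K times_divide_eq_right mult.assoc
      using D[of y] by (intro divide_right_mono) auto
  qed
  have "cos (\<nu> * x) * exp (- \<nu> * \<eta>) * arctan (sinh (\<eta> / 2) / sin (x / 2)) \<le> integral {0..\<eta>} (\<lambda>y. Im (kern \<nu> (Complex x y)))"
  proof (rule has_integral_le[OF _ integrable_integral[OF Im_vert_integral(2)[OF x(1,2)]]])
    show "((\<lambda>y. cos (\<nu> * x) * exp (- \<nu> * \<eta>) * (sin (x / 2) * cosh (y / 2) / D y)) has_integral
       cos (\<nu> * x) * exp (- \<nu> * \<eta>) * arctan (sinh (\<eta> / 2) / sin (x / 2))) {0..\<eta>}"
      using at Y by (intro has_integral_mult_right) auto
    fix y assume y: "y \<in> {0..\<eta>}"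
    have "cos (\<nu> * x) * exp (- \<nu> * \<eta>) * (sin (x / 2) * cosh (y / 2) / D y) \<le>
       exp (- \<nu> * y) * cos (\<nu> * x) * (sin (x / 2) * cosh (y / 2) / D y)"
    proof (rule mult_right_mono)
      have "exp (- \<nu> * \<eta>) \<le> exp (- \<nu> * y)" using y assms by (simp add: mult_left_mono)
      then show "cos (\<nu> * x) * exp (- \<nu> * \<eta>) \<le> exp (- \<nu> * y) * cos (\<nu> * x)"
        using cn by (subst mult.commute) (rule mult_right_mono)
    qed (use s D[of y] in auto)
    then show "cos (\<nu> * x) * exp (- \<nu> * \<eta>) * (sin (x / 2) * cosh (y / 2) / D y) \<le> Im (kern \<nu> (Complex x y))"
      using low[of y] y by (intro order_trans[OF _ low]) auto
  qed
  also have "\<dots> \<le> Im (vert_integral \<nu> x Y)"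
    unfolding Im_vert_integral(1)[OF x(1,2)]
  proof (rule integral_subset_le[OF _ Im_vert_integral(2)[OF x(1,2)] Im_vert_integral(2)[OF x(1,2)]])
    have "0 \<le> Im (kern \<nu> (Complex x y))" if "y \<ge> 0" for y
      using s D[of y] cn that by (intro order_trans[OF _ low]) auto
    then show "\<forall>y\<in>{0..Y}. 0 \<le> Im (kern \<nu> (Complex x y))" by auto
  qed (use Y in auto)
  finally show "ImL x (\<nu> - 1/2) \<ge> cos (\<nu> * x) * exp (- \<nu> * sqrt x) * arctan (sinh (sqrt x / 2) / sin (x / 2)) -
      4 * exp (- (1 / sqrt x) / 2)"
    using approx unfolding Y_def \<eta>_def by linarith
qed

text \<open>In the upper bound \<open>sin (\<nu> * x)\<close> is O(x) against a bracket of order 1 /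
  \<open>sqrt x\<close>; in the lower bound the argument of arctan grows like 1 /
  \<open>sqrt x\<close> while the factors before it tend to 1.\<close>

lemma ImL_tendsto:
  assumes "\<nu> \<ge> 0"
  shows "((\<lambda>x. ImL x (\<nu> - 1/2)) \<longlongrightarrow> pi / 2) (at_right 0)"
proof -
  have "\<forall>\<^sub>F x in at_right 0. 0 < x \<and> x \<le> 1 \<and> \<nu> * x \<le> pi / 2"
  proof -
    have "((\<lambda>x. \<nu> * x) \<longlongrightarrow> \<nu> * 0) (at_right 0)" by (intro tendsto_intros)
    then have "\<forall>\<^sub>F x in at_right 0. \<nu> * x < pi / 2" by (rule order_tendstoD) simp
    moreover have "\<forall>\<^sub>F x::real in at_right 0. x \<in> {0<..<1}" by (rule eventually_at_right_real) simp
    ultimately show ?thesis by eventually_elim auto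
  qed
  then have ev: "\<forall>\<^sub>F x in at_right 0. ImL x (\<nu> - 1/2) \<le> pi / 2 +
      sin (\<nu> * x) * (ln (1 + exp (1 / sqrt x)) / 2 - ln ((sin (x / 2))\<^sup>2) / 2) +
      4 * exp (- (1 / sqrt x) / 2)"
    "\<forall>\<^sub>F x in at_right 0. ImL x (\<nu> - 1/2) \<ge> cos (\<nu> * x) * exp (- \<nu> * sqrt x) * arctan (sinh (sqrt x / 2) / sin (x / 2)) -
      4 * exp (- (1 / sqrt x) / 2)"
    by (eventually_elim, use ImL_near_zero assms in blast)+
  show ?thesis
  proof (rule tendsto_sandwich[OF ev(2,1)])
    show "((\<lambda>x. cos (\<nu> * x) * exp (- \<nu> * sqrt x) * arctan (sinh (sqrt x / 2) / sin (x / 2)) -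
      4 * exp (- (1 / sqrt x) / 2)) \<longlongrightarrow> pi / 2) (at_right 0)"
      unfolding sinh_field_def by real_asymp
    show "((\<lambda>x. pi / 2 +
      sin (\<nu> * x) * (ln (1 + exp (1 / sqrt x)) / 2 - ln ((sin (x / 2))\<^sup>2) / 2) +
      4 * exp (- (1 / sqrt x) / 2)) \<longlongrightarrow> pi / 2) (at_right 0)"
    proof -
      have "((\<lambda>x. sin (\<nu> * x) * (ln (1 + exp (1 / sqrt x)) / 2 - ln ((sin (x / 2))\<^sup>2) / 2)) \<longlongrightarrow> 0) (at_right 0)"
      \<comment> \<open>For \<open>\<nu> = 0\<close> the product is identically 0; otherwise the
        sign of \<nu> fixes the leading term of the expansion.\<close>
      proof (cases "\<nu> = 0")
        case False
        with assms have "\<nu> > 0" by simp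
        then show ?thesis by real_asymp
      qed simp
      from tendsto_add[OF tendsto_add[OF tendsto_const[of "pi / 2"] this]]
      have "((\<lambda>x. pi / 2 + sin (\<nu> * x) * (ln (1 + exp (1 / sqrt x)) / 2 - ln ((sin (x / 2))\<^sup>2) / 2) + 4 * exp (- (1 / sqrt x) / 2))
         \<longlongrightarrow> pi / 2 + 0 + 0) (at_right 0)"
        by this real_asymp
      then show ?thesis by simp
    qed
  qed
qed

lemma ImL_0:
  assumes "\<nu> \<ge> 0"
  shows "ImL 0 (\<nu> - 1/2) = pi / 2"
proof -
  have "((\<lambda>t. Im (exp (\<i> * of_real (t * (\<nu> - 1/2))) * L t (\<nu> - 1/2))) \<longlongrightarrow> pi / 2) (at_right 0)"
    using ImL_tendsto[OF assms]
    by (rule Lim_transform_eventually)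
       (rule eventually_mono[OF eventually_at_right_real[of 0 1]], simp_all only: ImL_def zero_less_one, simp)
  then have "Lim (at_right 0) (\<lambda>t. Im (exp (\<i> * of_real (t * (\<nu> - 1/2))) * L t (\<nu> - 1/2))) = pi / 2"
    by (intro tendsto_Lim) simp_all
  then show ?thesis unfolding ImL_def by (simp only: if_True refl)
qed

section \<open>Large values of the argument of arccot\<close>

text \<open>With t = 1/a this is the Pade bound 3t/(3 + t^2) \<le> arctan t; the derivative of the
  difference is a multiple of t^4.\<close>

lemma arccot_ge:
  fixes a :: real
  assumes "a > 0"
  shows "3 * a / (3 * a\<^sup>2 + 1) \<le> arccot a"
proof -
  define h where "h = (\<lambda>t::real. arctan t - 3 * t / (3 + t\<^sup>2))"
  have "h 0 \<le> h (1 / a)"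
  proof (rule DERIV_nonneg_imp_nondecreasing[of 0 "1 / a" h])
    fix t :: real
    have "3 + t\<^sup>2 \<noteq> 0" "1 + t\<^sup>2 \<noteq> 0" "3 + t\<^sup>2 > 0" "1 + t\<^sup>2 > 0"
      by (smt (verit) zero_le_power2)+
    then have "(h has_real_derivative 1 / (1 + t\<^sup>2) - (9 - 3 * t\<^sup>2) / (3 + t\<^sup>2)\<^sup>2) (at t)"
      unfolding h_def
      by (auto intro!: derivative_eq_intros simp: power2_eq_square field_simps)
    moreover have "1 / (1 + t\<^sup>2) - (9 - 3 * t\<^sup>2) / (3 + t\<^sup>2)\<^sup>2 = 4 * t ^ 4 / ((1 + t\<^sup>2) * (3 + t\<^sup>2)\<^sup>2)"
      using \<open>3 + t\<^sup>2 \<noteq> 0\<close> \<open>1 + t\<^sup>2 \<noteq> 0\<close>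
      by (simp add: divide_simps) algebra
    moreover have "\<dots> \<ge> 0" using \<open>1 + t\<^sup>2 > 0\<close> by simp
    ultimately show "\<exists>y. (h has_real_derivative y) (at t) \<and> 0 \<le> y" by auto
  qed (use assms in auto)
  moreover have "3 * (1 / a) / (3 + (1 / a)\<^sup>2) = 3 * a / (3 * a\<^sup>2 + 1)"
    using assms by (simp add: field_simps power2_eq_square)
  moreover have "arctan (1 / a) = arccot a"
    using assms arctan_inverse[of a] by (simp add: arccot_def inverse_eq_divide)
  ultimately show ?thesis by (simp add: h_def)
qed

text \<open>The bound is the full Laplace transform of \<open>P\<close> at \<open>a\<close>, by the
  moments n!/a^(n+1) of the exponential weight. Nonnegativity of \<open>P\<close> lets it dominate
  the integral over a finite interval.\<close>

lemma integral_le_laplace_quartic: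
  fixes f :: "real \<Rightarrow> real" and a k Y d0 d2 d3 d4 :: real
  defines "P \<equiv> \<lambda>v. d0 + d2 * v\<^sup>2 + d3 * v ^ 3 + d4 * v ^ 4"
  assumes a: "a > 0" and k: "k > 0" and "Y \<ge> 0" and f: "f integrable_on {0..Y}"
    and le: "\<And>y. 0 \<le> y \<Longrightarrow> f y \<le> exp (- a * (k * y)) * P (k * y) * k"
    and P: "\<And>v. 0 \<le> v \<Longrightarrow> P v \<ge> 0"
  shows "integral {0..Y} f \<le> d0 / a + 2 * d2 / a ^ 3 + 6 * d3 / a ^ 4 + 24 * d4 / a ^ 5"
proof -
  define b where "b = 1 / a"
  have ab: "a * b = 1" using a by (simp add: b_def)
  \<comment> \<open>Coefficients of the polynomial solution \<open>S\<close> of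
    \<open>a * S - S' = P\<close>, namely the sum of the j-th derivatives of \<open>P\<close> times
    \<open>b ^ (j + 1)\<close>; then \<open>- exp (- a * v) * S v\<close> is an antiderivative of
    the weighted \<open>P\<close>.\<close>
  define e0 e1 e2 e3 e4 where "e0 = d0 * b + 2 * d2 * b ^ 3 + 6 * d3 * b ^ 4 + 24 * d4 * b ^ 5"
    and "e1 = 2 * d2 * b\<^sup>2 + 6 * d3 * b ^ 3 + 24 * d4 * b ^ 4"
    and "e2 = d2 * b + 3 * d3 * b\<^sup>2 + 12 * d4 * b ^ 3"
    and "e3 = d3 * b + 4 * d4 * b\<^sup>2" and "e4 = d4 * b"
  define S where "S = (\<lambda>v. e0 + e1 * v + e2 * v\<^sup>2 + e3 * v ^ 3 + e4 * v ^ 4)"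
  define S' where "S' = (\<lambda>v. e1 + 2 * e2 * v + 3 * e3 * v\<^sup>2 + 4 * e4 * v ^ 3)"
  define \<Psi> where "\<Psi> = (\<lambda>v. - exp (- a * v) * S v)"
  have S: "(S has_real_derivative S' v) (at v)" for v
    unfolding S_def S'_def by (auto intro!: derivative_eq_intros simp: power2_eq_square)
  have SP: "a * S v - S' v = P v" for v
    using ab unfolding S_def S'_def P_def e0_def e1_def e2_def e3_def e4_def by algebra
  have "(\<Psi> has_real_derivative exp (- a * v) * (a * S v - S' v)) (at v)" for v
    unfolding \<Psi>_def using S[of v] by (auto intro!: derivative_eq_intros simp: algebra_simps)
  then have D: "(\<Psi> has_real_derivative exp (- a * v) * P v) (at v)" for v
    by (simp only: SP)
  have lim: "(\<Psi> \<longlongrightarrow> 0) at_top"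
  proof -
    have "((\<lambda>v. exp (- a * v)) \<longlongrightarrow> 0) at_top" "((\<lambda>v. exp (- a * v) * v) \<longlongrightarrow> 0) at_top"
      "((\<lambda>v. exp (- a * v) * v\<^sup>2) \<longlongrightarrow> 0) at_top" "((\<lambda>v. exp (- a * v) * v ^ 3) \<longlongrightarrow> 0) at_top"
      "((\<lambda>v. exp (- a * v) * v ^ 4) \<longlongrightarrow> 0) at_top"
      using a by real_asymp+
    then have "((\<lambda>v. - (e0 * exp (- a * v) + e1 * (exp (- a * v) * v) + e2 * (exp (- a * v) * v\<^sup>2) +
       e3 * (exp (- a * v) * v ^ 3) + e4 * (exp (- a * v) * v ^ 4))) \<longlongrightarrow> - (e0 * 0 + e1 * 0 + e2 * 0 + e3 * 0 + e4 * 0)) at_top"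
      by (intro tendsto_intros)
    then show ?thesis by (simp add: \<Psi>_def S_def algebra_simps)
  qed
  \<comment> \<open>\<open>\<Psi>\<close> is nondecreasing on the half-line with limit 0, so the
    upper boundary term has the right sign to be dropped.\<close>
  have neg: "\<Psi> v \<le> 0" if "v \<ge> 0" for v
  proof (rule tendsto_lowerbound[OF lim])
    show "\<forall>\<^sub>F w in at_top. \<Psi> v \<le> \<Psi> w"
      using eventually_ge_at_top[of v]
    proof eventually_elim
      case (elim w)
      show ?case
      proof (rule DERIV_nonneg_imp_nondecreasing[OF elim])
        fix t assume "v \<le> t"
        then show "\<exists>y. (\<Psi> has_real_derivative y) (at t) \<and> 0 \<le> y"
          using D[of t] P[of t] that by (intro exI[of _ "exp (- a * t) * P t"]) auto
      qed
    qed
  qed simp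
  have "((\<lambda>y. exp (- a * (k * y)) * P (k * y) * k) has_integral \<Psi> (k * Y) - \<Psi> (k * 0)) {0..Y}"
  proof (rule fundamental_theorem_of_calculus[OF \<open>Y \<ge> 0\<close>])
    fix y
    have "((\<lambda>y. \<Psi> (k * y)) has_real_derivative exp (- a * (k * y)) * P (k * y) * k) (at y within {0..Y})"
      by (rule DERIV_chain2[OF D]) (auto intro!: derivative_eq_intros)
    then show "((\<lambda>y. \<Psi> (k * y)) has_vector_derivative exp (- a * (k * y)) * P (k * y) * k) (at y within {0..Y})"
      by (simp add: has_real_derivative_iff_has_vector_derivative)
  qed
  then have "integral {0..Y} f \<le> \<Psi> (k * Y) - \<Psi> (k * 0)"
    by (rule has_integral_le[OF integrable_integral[OF f]]) (use le in auto)
  also have "\<dots> \<le> - \<Psi> 0" using neg[of "k * Y"] k \<open>Y \<ge> 0\<close> by simp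
  also have "\<dots> = d0 / a + 2 * d2 / a ^ 3 + 6 * d3 / a ^ 4 + 24 * d4 / a ^ 5"
    by (simp add: \<Psi>_def S_def e0_def b_def power_divide)
  finally show ?thesis .
qed

text \<open>The second inequality bounds \<open>a\<close> times the Laplace transform of the majorant at \<open>a\<close>.\<close>

lemma quartic_majorant:
  fixes a :: real
  assumes "a \<ge> 2"
  obtains c2 c3 c4 :: real
  where "\<And>v. v \<ge> 0 \<Longrightarrow> 1 / (1 + v\<^sup>2) \<le> 1 + c2 * v\<^sup>2 + c3 * v ^ 3 + c4 * v ^ 4"
    and "1 + 2 * c2 / a\<^sup>2 + 6 * c3 / a ^ 3 + 24 * c4 / a ^ 4 \<le> (3 * a\<^sup>2 / (3 * a\<^sup>2 + 1))\<^sup>2"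
proof (cases "a \<le> 3")
  case True
  \<comment> \<open>Tangent line of \<open>1 / (1 + v\<^sup>2)\<close> at \<open>m\<close>, the mean of \<open>v\<close> for the weight \<open>v\<^sup>2 exp (- a v)\<close>.
     It bounds the function from below on the half-line only if \<open>m \<ge> 1\<close>.\<close>
  define m where "m = 3 / a"
  have m: "m \<ge> 1" using assms True by (simp add: m_def)
  have M: "(1 + m\<^sup>2)\<^sup>2 > 0" by (smt (verit) zero_le_power2 zero_less_power)
  show ?thesis
  proof (rule that[of "- (1 + 3 * m\<^sup>2) / (1 + m\<^sup>2)\<^sup>2" "2 * m / (1 + m\<^sup>2)\<^sup>2" 0])
    fix v :: real assume "v \<ge> 0"
    have v: "1 + v\<^sup>2 > 0" by (smt (verit) zero_le_power2)
    have "(1 + - (1 + 3 * m\<^sup>2) / (1 + m\<^sup>2)\<^sup>2 * v\<^sup>2 + 2 * m / (1 + m\<^sup>2)\<^sup>2 * v ^ 3 + 0 * v ^ 4) * (1 + v\<^sup>2) - 1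
      = v\<^sup>2 * (v - m)\<^sup>2 * (2 * m * v + m\<^sup>2 - 1) / (1 + m\<^sup>2)\<^sup>2"
      using M by (simp add: divide_simps) algebra
    also have "\<dots> \<ge> 0" using \<open>v \<ge> 0\<close> m one_le_power[OF m, of 2] by (intro divide_nonneg_nonneg mult_nonneg_nonneg) (auto intro!: add_increasing)
    finally show "1 / (1 + v\<^sup>2) \<le> 1 + - (1 + 3 * m\<^sup>2) / (1 + m\<^sup>2)\<^sup>2 * v\<^sup>2 + 2 * m / (1 + m\<^sup>2)\<^sup>2 * v ^ 3 + 0 * v ^ 4"
      using v by (simp add: pos_divide_le_eq)
  next
    define q where "q = a\<^sup>2"
    have q: "q \<ge> 4" using power_mono[of 2 a 2] assms by (simp add: q_def)
    have "1 + m\<^sup>2 = (q + 9) / q" using assms by (simp add: m_def q_def power_divide add_divide_distrib)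
    then have M': "(1 + m\<^sup>2)\<^sup>2 = (q + 9)\<^sup>2 / q\<^sup>2" by (simp add: power_divide)
    have a3: "2 * m / (1 + m\<^sup>2)\<^sup>2 / a ^ 3 = 6 / (q + 9)\<^sup>2"
      unfolding M' using assms q by (simp add: m_def q_def power2_eq_square power3_eq_cube)
    have a2: "(1 + 3 * m\<^sup>2) / (1 + m\<^sup>2)\<^sup>2 / a\<^sup>2 = (q + 27) / (q + 9)\<^sup>2"
    proof -
      have "1 + 3 * m\<^sup>2 = (q + 27) / q" using assms by (simp add: m_def q_def power_divide add_divide_distrib)
      then show ?thesis unfolding M' q_def[symmetric] using q by (simp add: power2_eq_square)
    qed
    have "1 + 2 * (- (1 + 3 * m\<^sup>2) / (1 + m\<^sup>2)\<^sup>2) / a\<^sup>2 + 6 * (2 * m / (1 + m\<^sup>2)\<^sup>2) / a ^ 3 + 24 * 0 / a ^ 4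
      = 1 - 2 * ((q + 27) / (q + 9)\<^sup>2) + 6 * (6 / (q + 9)\<^sup>2)"
    proof -
      have "1 + 2 * (- X / M) / A + 6 * Z / B + 24 * 0 / C = 1 - 2 * (X / M / A) + 6 * (Z / B)"
        for X M A Z B C :: real by simp
      then show ?thesis unfolding a2[symmetric] a3[symmetric] .
    qed
    also have "\<dots> = (q + 7) / (q + 9)"
      using q by (simp add: divide_simps) algebra
    also have "\<dots> \<le> (3 * q / (3 * q + 1))\<^sup>2"
    proof -
      \<comment> \<open>The difference of the cross-multiplied sides, arranged so that
        \<open>q\<close> \<ge> 4 shows its sign.\<close>
      have "0 \<le> 12 * q * (q - 4) + 5 * q - 7" using q mult_nonneg_nonneg[of "12 * q" "q - 4"] by linarith
      then have "(q + 7) * (3 * q + 1)\<^sup>2 \<le> (3 * q)\<^sup>2 * (q + 9)"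
        by (simp add: algebra_simps power2_eq_square)
      then show ?thesis using q by (simp add: power_divide divide_simps)
    qed
    finally show "1 + 2 * (- (1 + 3 * m\<^sup>2) / (1 + m\<^sup>2)\<^sup>2) / a\<^sup>2 + 6 * (2 * m / (1 + m\<^sup>2)\<^sup>2) / a ^ 3 + 24 * 0 / a ^ 4
      \<le> (3 * a\<^sup>2 / (3 * a\<^sup>2 + 1))\<^sup>2" by (simp only: q_def)
  qed
next
  case False
  define q where "q = a\<^sup>2"
  have q: "q \<ge> 9" using power_mono[of 3 a 2] False by (simp add: q_def)
  \<comment> \<open>Now the tangent line of \<open>1 / (1 + w)\<close> in \<open>w = v\<^sup>2\<close>, at the mean of \<open>w\<close> for the same weight.\<close>
  define r where "r = 12 / q"
  have "r > 0" using q by (simp add: r_def)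
  then have M: "(1 + r)\<^sup>2 > 0" by (intro zero_less_power) simp
  show ?thesis
  proof (rule that[of "- (1 + 2 * r) / (1 + r)\<^sup>2" 0 "1 / (1 + r)\<^sup>2"])
    fix v :: real
    have v: "1 + v\<^sup>2 > 0" by (smt (verit) zero_le_power2)
    have "(1 + - (1 + 2 * r) / (1 + r)\<^sup>2 * v\<^sup>2 + 0 * v ^ 3 + 1 / (1 + r)\<^sup>2 * v ^ 4) * (1 + v\<^sup>2) - 1
      = v\<^sup>2 * (v\<^sup>2 - r)\<^sup>2 / (1 + r)\<^sup>2"
      using M by (simp add: divide_simps) algebra
    also have "\<dots> \<ge> 0" by simp
    finally show "1 / (1 + v\<^sup>2) \<le> 1 + - (1 + 2 * r) / (1 + r)\<^sup>2 * v\<^sup>2 + 0 * v ^ 3 + 1 / (1 + r)\<^sup>2 * v ^ 4"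
      using v by (simp add: pos_divide_le_eq)
  next
    have r: "1 + r = (q + 12) / q" "1 + 2 * r = (q + 24) / q" using q by (simp_all add: r_def field_simps)
    have "a ^ 4 = q\<^sup>2" by (simp add: q_def flip: power_mult)
    then have "1 + 2 * (- (1 + 2 * r) / (1 + r)\<^sup>2) / a\<^sup>2 + 6 * 0 / a ^ 3 + 24 * (1 / (1 + r)\<^sup>2) / a ^ 4
      = 1 - 2 * (q + 24) / (q + 12)\<^sup>2 + 24 / (q + 12)\<^sup>2"
      unfolding r q_def[symmetric] using q by (simp add: power_divide power2_eq_square)
    also have "\<dots> = (q + 10) / (q + 12)"
      using q by (simp add: divide_simps) algebra
    also have "\<dots> \<le> (3 * q / (3 * q + 1))\<^sup>2"
    proof -
      have "0 \<le> 12 * q * (q - 9) + 47 * q - 10" using q mult_nonneg_nonneg[of "12 * q" "q - 9"] by linarith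
      then have "(q + 10) * (3 * q + 1)\<^sup>2 \<le> (3 * q)\<^sup>2 * (q + 12)"
        by (simp add: algebra_simps power2_eq_square)
      then show ?thesis using q by (simp add: power_divide divide_simps)
    qed
    finally show "1 + 2 * (- (1 + 2 * r) / (1 + r)\<^sup>2) / a\<^sup>2 + 6 * 0 / a ^ 3 + 24 * (1 / (1 + r)\<^sup>2) / a ^ 4
      \<le> (3 * a\<^sup>2 / (3 * a\<^sup>2 + 1))\<^sup>2" by (simp only: q_def)
  qed
qed

lemma le_of_exp_error:
  fixes b c :: real
  assumes "\<And>Y. Y \<ge> 1 \<Longrightarrow> b \<le> c + 4 * exp (- Y / 2)"
  shows "b \<le> c"
proof -
  have "((\<lambda>Y. c + 4 * exp (- Y / 2)) \<longlongrightarrow> c) at_top" by real_asymp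
  then show ?thesis
    by (rule tendsto_lowerbound[OF _ eventually_mono[OF eventually_ge_at_top assms]]) simp_all
qed

text \<open>Since sinh t \<ge> t for t \<ge> 0, the rescaling v = y / (2s) brings the norm of the
  kernel below \<open>exp (- a * v) / sqrt (1 + v\<^sup>2)\<close>. AM-GM removes the square root,
  leaving a polynomial majorant.\<close>

lemma abs_ImL_le_of_ge_2:
  assumes x: "0 < x" "x \<le> pi" and "\<nu> \<ge> 0" and a2: "2 * \<nu> * sin (x / 2) \<ge> 2"
  shows "\<bar>ImL x (\<nu> - 1/2)\<bar> \<le> arccot (2 * \<nu> * sin (x / 2))"
proof -
  define s a where "s = sin (x / 2)" and "a = 2 * \<nu> * s"
  have x': "x < 2 * pi" using x pi_gt_zero by linarith
  have s: "s > 0" using x x' unfolding s_def by (intro sin_gt_zero) auto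
  have a: "a \<ge> 2" using a2 by (simp add: a_def s_def)
  obtain c2 c3 c4 where c: "\<And>v. v \<ge> 0 \<Longrightarrow> 1 / (1 + v\<^sup>2) \<le> 1 + c2 * v\<^sup>2 + c3 * v ^ 3 + c4 * v ^ 4"
    and \<sigma>: "1 + 2 * c2 / a\<^sup>2 + 6 * c3 / a ^ 3 + 24 * c4 / a ^ 4 \<le> (3 * a\<^sup>2 / (3 * a\<^sup>2 + 1))\<^sup>2"
    using quartic_majorant[OF a] by blast
  \<comment> \<open>\<open>\<tau> / a\<close> is the target bound. The left side of
    \<open>\<sigma>\<close> is at most \<open>\<tau>\<^sup>2\<close>, so the AM-GM average with
    weight \<open>\<tau>\<close> is at most \<open>\<tau>\<close>.\<close>
  define \<tau> where "\<tau> = 3 * a\<^sup>2 / (3 * a\<^sup>2 + 1)"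
  have \<tau>: "\<tau> > 0" using a by (simp add: \<tau>_def add_pos_nonneg)
  define k where "k = 1 / (2 * s)"
  have k: "k > 0" using s by (simp add: k_def)
  define P where "P = (\<lambda>v. (\<tau> + 1 / \<tau>) / 2 + c2 / (2 * \<tau>) * v\<^sup>2 + c3 / (2 * \<tau>) * v ^ 3 + c4 / (2 * \<tau>) * v ^ 4)"
  have Pv: "1 / sqrt (1 + v\<^sup>2) \<le> P v" if "v \<ge> 0" for v
  proof -
    \<comment> \<open>AM-GM: \<open>w \<le> (\<tau> + w\<^sup>2 / \<tau>) / 2\<close>\<close>
    define w where "w = 1 / sqrt (1 + v\<^sup>2)"
    have "0 \<le> (\<tau> - w)\<^sup>2 / (2 * \<tau>)" using \<tau> by simp
    also have "\<dots> = (\<tau> + w\<^sup>2 / \<tau>) / 2 - w"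
      using \<tau> by (simp add: field_simps power2_eq_square)
    finally have "w \<le> (\<tau> + w\<^sup>2 / \<tau>) / 2" by simp
    also have "w\<^sup>2 = 1 / (1 + v\<^sup>2)" by (simp add: w_def power_divide add_nonneg_nonneg)
    also have "(\<tau> + 1 / (1 + v\<^sup>2) / \<tau>) / 2 \<le> (\<tau> + (1 + c2 * v\<^sup>2 + c3 * v ^ 3 + c4 * v ^ 4) / \<tau>) / 2"
      using \<tau> c[OF that] by (intro divide_right_mono add_left_mono) auto
    also have "\<dots> = P v" using \<tau> by (simp add: P_def field_simps)
    finally show ?thesis unfolding w_def .
  qed
  have P0: "P v \<ge> 0" if "v \<ge> 0" for v
    using Pv[OF that] by (rule order_trans[rotated]) (simp add: add_nonneg_nonneg)
  have kern: "norm (kern \<nu> (Complex x y)) \<le> exp (- a * (k * y)) * P (k * y) * k" if "y \<ge> 0" for y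
  proof -
    have "y / 2 \<le> sinh (y / 2)"
    proof -
      have "0 \<le> sinh (y / 2) - y / 2"
      proof -
        have "(\<lambda>t. sinh t - t) 0 \<le> (\<lambda>t. sinh t - t) (y / 2)"
        proof (rule DERIV_nonneg_imp_nondecreasing[of 0 "y / 2" "\<lambda>t. sinh t - t"])
          fix t :: real
          show "\<exists>d. ((\<lambda>t. sinh t - t) has_real_derivative d) (at t) \<and> 0 \<le> d"
            using cosh_real_ge_1[of t] by (intro exI[of _ "cosh t - 1"]) (auto intro!: derivative_eq_intros)
        qed (use that in simp)
        then show ?thesis by simp
      qed
      then show ?thesis by simp
    qed
    then have "(y / 2)\<^sup>2 \<le> (sinh (y / 2))\<^sup>2" using that by (intro power_mono) auto
    moreover have "s\<^sup>2 * (1 + (k * y)\<^sup>2) = s\<^sup>2 + (y / 2)\<^sup>2"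
      using s by (simp add: k_def power_divide field_simps power_mult_distrib)
    ultimately have "s * sqrt (1 + (k * y)\<^sup>2) \<le> sqrt (s\<^sup>2 + (sinh (y / 2))\<^sup>2)"
      using s by (intro real_le_rsqrt) (simp add: power_mult_distrib add_nonneg_nonneg)
    then have "norm (kern \<nu> (Complex x y)) \<le> exp (- \<nu> * y) / (2 * (s * sqrt (1 + (k * y)\<^sup>2)))"
      unfolding norm_kern s_def[symmetric] using s by (intro divide_left_mono) (auto intro!: mult_pos_pos add_pos_nonneg)
    also have "\<dots> = exp (- a * (k * y)) * (1 / sqrt (1 + (k * y)\<^sup>2)) * k"
      using s by (simp add: k_def a_def)
    also have "\<dots> \<le> exp (- a * (k * y)) * P (k * y) * k"
      using k that by (intro mult_right_mono mult_left_mono Pv) auto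
    finally show ?thesis .
  qed
  have bound: "\<bar>Im (vert_integral \<nu> x Y)\<bar> \<le> 3 * a / (3 * a\<^sup>2 + 1)" if "Y \<ge> 0" for Y
  proof -
    have int: "(\<lambda>y. norm (kern \<nu> (Complex x y))) integrable_on {0..Y}" 
      using continuous_on_kern[OF x(1) x'] by (intro integrable_continuous_real continuous_on_norm)
    have "norm (vert_integral \<nu> x Y) \<le> integral {0..Y} (\<lambda>y. norm (kern \<nu> (Complex x y)))"
      unfolding vert_integral_def using continuous_on_kern[OF x(1) x'] int
      by (intro integral_norm_bound_integral int) (auto intro: integrable_continuous_real)
    also have "\<dots> \<le> (\<tau> + 1 / \<tau>) / 2 / a + 2 * (c2 / (2 * \<tau>)) / a ^ 3 + 6 * (c3 / (2 * \<tau>)) / a ^ 4 + 24 * (c4 / (2 * \<tau>)) / a ^ 5"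
      using a k that int kern P0 unfolding P_def by (intro integral_le_laplace_quartic) auto
    also have "\<dots> = (\<tau> + (1 + 2 * c2 / a\<^sup>2 + 6 * c3 / a ^ 3 + 24 * c4 / a ^ 4) / \<tau>) / (2 * a)"
      using \<tau> a by (simp add: field_simps power_numeral_reduce)
    also have "\<dots> \<le> (\<tau> + \<tau>\<^sup>2 / \<tau>) / (2 * a)"
      using \<sigma> \<tau> a unfolding \<tau>_def[symmetric] by (intro divide_right_mono add_left_mono) auto
    also have "\<dots> = \<tau> / a" using \<tau> by (simp add: power2_eq_square)
    also have "\<dots> = 3 * a / (3 * a\<^sup>2 + 1)" using a by (simp add: \<tau>_def power2_eq_square)
    finally show ?thesis using abs_Im_le_cmod order_trans by blast
  qed
  have "\<bar>ImL x (\<nu> - 1/2)\<bar> \<le> 3 * a / (3 * a\<^sup>2 + 1)"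
  proof (rule le_of_exp_error)
    fix Y :: real assume "Y \<ge> 1"
    then show "\<bar>ImL x (\<nu> - 1/2)\<bar> \<le> 3 * a / (3 * a\<^sup>2 + 1) + 4 * exp (- Y / 2)"
      using ImL_approx[OF x \<open>\<nu> \<ge> 0\<close>, of Y] bound[of Y] by linarith
  qed
  also have "\<dots> \<le> arccot a" using a by (intro arccot_ge) simp
  finally show ?thesis by (simp add: a_def s_def)
qed

section \<open>Small values of the argument of arccot\<close>

lemma cos_ge_quadratic:
  fixes x :: real
  shows "1 - x\<^sup>2 / 2 \<le> cos x"
proof -
  have "\<bar>sin (x / 2)\<bar> \<le> \<bar>x / 2\<bar>" by (rule abs_sin_x_le_abs_x)
  then have "(sin (x / 2))\<^sup>2 \<le> (x / 2)\<^sup>2" by (simp only: abs_le_square_iff)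
  moreover have "cos x = 1 - 2 * (sin (x / 2))\<^sup>2" using cos_double_sin[of "x / 2"] by simp
  ultimately show ?thesis by (simp add: power_divide)
qed

lemma sin_ge_cubic:
  fixes x :: real
  assumes "x \<ge> 0"
  shows "x - x ^ 3 / 6 \<le> sin x"
proof -
  have "sin 0 - (0 - 0 ^ 3 / 6) \<le> sin x - (x - x ^ 3 / 6)"
  proof (rule DERIV_nonneg_imp_nondecreasing[of 0 x "\<lambda>t. sin t - (t - t ^ 3 / 6)"])
    fix t :: real
    show "\<exists>d. ((\<lambda>t. sin t - (t - t ^ 3 / 6)) has_real_derivative d) (at t) \<and> 0 \<le> d"
      using cos_ge_quadratic[of t]
      by (intro exI[of _ "cos t - (1 - t\<^sup>2 / 2)"]) (auto intro!: derivative_eq_intros)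
  qed (use assms in simp)
  then show ?thesis by simp
qed

text \<open>A sharpened Jordan inequality with equality at both ends of the interval, needed to keep
  \<open>\<theta>\<close> away from \<pi> in \<open>mult_cos_le_sin\<close>. Near 0 the cubic bound
  for sin is enough, near \<pi>/2 the quadratic bound for cos.\<close>

lemma twice_le_sin_mult:
  fixes y :: real
  assumes y: "0 \<le> y" "y \<le> pi / 2"
  shows "2 * y \<le> sin y * (3 * pi / 4 + y / 2)"
proof (cases "y \<le> 5 / 4")
  case True
  have "y\<^sup>2 \<le> 5 / 4 * y" unfolding power2_eq_square using y True by (intro mult_right_mono)
  moreover have "y ^ 3 \<le> 25 / 16 * y"
  proof -
    have "y\<^sup>2 \<le> (5 / 4)\<^sup>2" using y True by (intro power_mono)
    then have "y\<^sup>2 * y \<le> (5 / 4)\<^sup>2 * y" using y by (intro mult_right_mono)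
    then show ?thesis by (simp add: power3_eq_cube power2_eq_square)
  qed
  ultimately have "1 / 4 + y / 2 - 3 / 8 * y\<^sup>2 - y ^ 3 / 12 \<ge> 0" using True by linarith
  then have "y * (1 / 4 + y / 2 - 3 / 8 * y\<^sup>2 - y ^ 3 / 12) \<ge> 0" using y by simp
  \<comment> \<open>Here 9/4 is \<open>3 * pi / 4\<close> with \<pi> replaced by 3.\<close>
  then have "2 * y \<le> (y - y ^ 3 / 6) * (9 / 4 + y / 2)"
    by (simp add: algebra_simps power2_eq_square power3_eq_cube)
  also have "\<dots> \<le> sin y * (9 / 4 + y / 2)"
    using sin_ge_cubic y by (intro mult_right_mono) auto
  also have "\<dots> \<le> sin y * (3 * pi / 4 + y / 2)"
    using y pi_gt3 by (intro mult_left_mono sin_ge_zero) auto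
  finally show ?thesis .
next
  case False
  define d where "d = pi / 2 - y"
  have d: "0 \<le> d" "d \<le> 3 / 4" using False y pi_less_4 by (auto simp: d_def)
  have "pi * d \<le> 4 * (3 / 4)" using d pi_less_4 by (intro mult_mono) auto
  then have "0 \<le> d * (3 / 2 - pi * d / 2 + d\<^sup>2 / 4)" using d by (intro mult_nonneg_nonneg add_nonneg_nonneg) auto
  then have "pi - 2 * d \<le> (1 - d\<^sup>2 / 2) * (pi - d / 2)"
    by (simp add: algebra_simps power2_eq_square)
  also have "\<dots> \<le> cos d * (pi - d / 2)"
    using d pi_gt3 cos_ge_quadratic by (intro mult_right_mono) auto
  also have "cos d = sin y" by (simp add: d_def cos_diff)
  finally show ?thesis by (simp add: d_def field_simps)
qed

lemma jordan_inequality: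
  fixes y :: real
  assumes y: "0 \<le> y" "y \<le> pi / 2"
  shows "2 * y \<le> pi * sin y"
proof -
  have "2 * y \<le> sin y * (3 * pi / 4 + y / 2)" using twice_le_sin_mult[OF y] .
  also have "\<dots> \<le> sin y * pi" using y by (intro mult_left_mono sin_ge_zero) auto
  finally show ?thesis by (simp add: mult.commute)
qed

text \<open>This is the derivative comparison between \<open>ImL\<close> and arccot: with
  \<open>y = t / 2\<close> and \<open>a = 2 * \<nu> * sin y\<close>, the argument
  \<open>a * y / sin y\<close> equals \<open>\<nu> * t\<close>.\<close>

lemma mult_cos_le_sin:
  fixes a y :: real
  assumes y: "0 < y" "y \<le> pi / 2" and a: "0 \<le> a" "a \<le> 2"
  shows "a * cos y \<le> sin (a * y / sin y) * (1 + a\<^sup>2)"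
proof -
  have s: "sin y > 0" using y by (intro sin_gt_zero) auto
  define \<theta> where "\<theta> = a * y / sin y"
  have "a * sin y \<le> a * y" using y a sin_x_le_x[of y] by (intro mult_left_mono) auto
  then have \<theta>1: "a \<le> \<theta>" using s by (simp add: \<theta>_def field_simps)
  have \<theta>2: "\<theta> \<le> 2 * y / sin y" unfolding \<theta>_def using y a s by (intro divide_right_mono mult_right_mono) auto
  have W: "2 * y / sin y \<le> 3 * pi / 4 + y / 2"
    using twice_le_sin_mult[of y] y s by (simp add: field_simps)
  show ?thesis
  proof (cases "\<theta> \<le> pi / 2")
    case True
    have "a\<^sup>2 \<le> 2\<^sup>2" using a by (intro power_mono)
    \<comment> \<open>Expanding the product below leaves exactly this excess over \<open>a\<close>,
      nonnegative since \<open>a\<^sup>2\<close> \<le> 4 < 5.\<close>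
    then have "0 \<le> a ^ 3 * (5 / 6 - a\<^sup>2 / 6)" using a by (intro mult_nonneg_nonneg) auto
    then have "a \<le> (a - a ^ 3 / 6) * (1 + a\<^sup>2)"
      by (simp add: algebra_simps power2_eq_square power3_eq_cube)
    also have "\<dots> \<le> sin a * (1 + a\<^sup>2)" using sin_ge_cubic[OF a(1)] by (intro mult_right_mono) auto
    also have "\<dots> \<le> sin \<theta> * (1 + a\<^sup>2)"
      using \<theta>1 True a pi_gt_zero by (intro mult_right_mono sin_monotone_2pi_le) auto
    finally have "a * 1 \<le> sin \<theta> * (1 + a\<^sup>2)" by simp
    moreover have "a * cos y \<le> a * 1" using a by (intro mult_left_mono) auto
    ultimately show ?thesis unfolding \<theta>_def by linarith
  next
    case False
    \<comment> \<open>By \<open>W\<close> the distance from \<open>\<theta>\<close> to \<pi> is at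
      least \<open>h\<close>, and \<open>cos y\<close> = sin(2h), so half of \<open>cos y\<close>
      stays below \<open>sin \<theta>\<close>.\<close>
    define h where "h = (pi / 2 - y) / 2"
    have "2 * h = pi / 2 - y" by (simp add: h_def)
    then have "cos y = 2 * sin h * cos h" using sin_double[of h] cos_sin_eq[of y] by simp
    then have "cos y / 2 = sin h * cos h" by simp
    also have "\<dots> \<le> sin h * 1"
      using y by (intro mult_left_mono sin_ge_zero) (auto simp: h_def)
    also have "\<dots> \<le> sin (pi - \<theta>)"
      using W \<theta>2 False y by (subst mult_1_right, intro sin_monotone_2pi_le) (auto simp: h_def)
    also have "\<dots> = sin \<theta>" by simp
    finally have "cos y / 2 \<le> sin \<theta>" .
    moreover have "2 * a \<le> 1 + a\<^sup>2" using zero_le_power2[of "a - 1"] by (simp add: power2_diff)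
    moreover have "cos y \<ge> 0" using y by (intro cos_ge_zero) auto
    ultimately have "(cos y / 2) * (2 * a) \<le> sin \<theta> * (1 + a\<^sup>2)" using a by (intro mult_mono) auto
    then show ?thesis by (simp add: \<theta>_def mult.commute)
  qed
qed

text \<open>The increments of \<open>ImL\<close> and of arccot are compared on the interval from
  \<open>z\<close> to \<open>x\<close>; as \<open>z\<close> tends to 0 both functions start from
  \<pi>/2.\<close>

lemma ImL_le_of_le_2:
  assumes x: "0 < x" "x \<le> pi" and \<nu>: "\<nu> \<ge> 0" and a2: "2 * \<nu> * sin (x / 2) \<le> 2"
  shows "ImL x (\<nu> - 1/2) \<le> arccot (2 * \<nu> * sin (x / 2))"
proof -
  define A where "A = (\<lambda>t. arccot (2 * \<nu> * sin (t / 2)))"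
  have diff: "ImL x (\<nu> - 1/2) - ImL z (\<nu> - 1/2) \<le> A x - A z" if z: "0 < z" "z \<le> x" for z
  proof (rule ImL_diff_le[OF z \<open>x \<le> pi\<close> \<nu>])
    fix t assume t: "z \<le> t" "t \<le> x"
    define s c where "s = sin (t / 2)" and "c = cos (t / 2)"
    have p: "1 + (2 * \<nu> * s)\<^sup>2 > 0" by (smt (verit) zero_le_power2)
    have "((\<lambda>t. 2 * \<nu> * sin (t / 2)) has_real_derivative \<nu> * c) (at t)"
      unfolding c_def by (auto intro!: derivative_eq_intros)
    then have "((\<lambda>t. arctan (2 * \<nu> * sin (t / 2))) has_real_derivative \<nu> * c * inverse (1 + (2 * \<nu> * s)\<^sup>2)) (at t)"
      unfolding s_def by (subst mult.commute) (rule DERIV_chain2[OF DERIV_arctan])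
    from DERIV_diff[OF DERIV_const[of "pi / 2"] this]
    show "(A has_real_derivative - (\<nu> * c) / (1 + (2 * \<nu> * s)\<^sup>2)) (at t)"
      unfolding A_def arccot_def divide_inverse[of "- _"] by simp
    have t0: "0 < t / 2" "t / 2 \<le> pi / 2" using t z x by auto
    have s: "s > 0" using t0 unfolding s_def by (intro sin_gt_zero) auto
    \<comment> \<open>Monotonicity of sin carries the bound 2 on the argument of arccot from
      \<open>x\<close> to every smaller \<open>t\<close>.\<close>
    have "s \<le> sin (x / 2)" unfolding s_def using t t0 x by (intro sin_monotone_2pi_le) auto
    then have "2 * \<nu> * s \<le> 2 * \<nu> * sin (x / 2)" using \<nu> by (intro mult_left_mono) auto
    then have "2 * \<nu> * s * c \<le> sin (2 * \<nu> * s * (t / 2) / s) * (1 + (2 * \<nu> * s)\<^sup>2)"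
      unfolding c_def s_def using a2 \<nu> s t0 by (intro mult_cos_le_sin) (auto simp: s_def)
    also have "2 * \<nu> * s * (t / 2) / s = \<nu> * t" using s by simp
    finally have "\<nu> * c / (1 + (2 * \<nu> * s)\<^sup>2) \<le> sin (\<nu> * t) / (2 * s)"
      using p s by (simp add: divide_simps mult_ac)
    then show "- sin (\<nu> * t) / (2 * sin (t / 2)) \<le> - (\<nu> * c) / (1 + (2 * \<nu> * s)\<^sup>2)"
      by (simp add: s_def)
  qed
  have "(A \<longlongrightarrow> A 0) (at_right 0)"
    unfolding A_def arccot_def by (intro tendsto_intros) auto
  then have "((\<lambda>z. A x - A z + ImL z (\<nu> - 1/2)) \<longlongrightarrow> A x - A 0 + pi / 2) (at_right 0)"
    using ImL_tendsto[OF \<nu>] by (intro tendsto_intros)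
  moreover have "\<forall>\<^sub>F z in at_right 0. ImL x (\<nu> - 1/2) \<le> A x - A z + ImL z (\<nu> - 1/2)"
    using eventually_at_right_real[OF x(1)]
  proof eventually_elim
    case (elim z)
    then show ?case using diff[of z] by simp
  qed
  ultimately have "ImL x (\<nu> - 1/2) \<le> A x - A 0 + pi / 2"
    by (rule tendsto_lowerbound) simp
  then show ?thesis by (simp add: A_def arccot_def)
qed

section \<open>Lower bound when the argument of arccot is at most 2\<close>

lemma inverse_one_plus_le:
  fixes w :: real
  assumes "w \<ge> 0"
  shows "1 / (1 + w) \<le> 1 - 2 / 3 * w + w\<^sup>2 / 5"
proof -
  \<comment> \<open>The excess after multiplication by \<open>1 + w\<close>, with the square
    completed.\<close>
  have "0 \<le> w * ((w - 7 / 6)\<^sup>2 / 5 + 11 / 180)" using assms by simp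
  also have "\<dots> = (1 - 2 / 3 * w + w\<^sup>2 / 5) * (1 + w) - 1" by (simp add: field_simps power2_eq_square)
  finally show ?thesis using assms by (simp add: pos_divide_le_eq)
qed

text \<open>For \<nu> \<le> 1/2 the integrand at \<open>x = pi\<close> is nonnegative. Beyond that,
  bounding 1/(1 + \<open>exp (- y)\<close>) by a quadratic in \<open>exp (- y)\<close> majorises the
  negated integrand by three exponentials, which leaves a rational inequality in
  \<open>a\<close>.\<close>

lemma ImL_pi_ge:
  assumes "0 \<le> \<nu>" "\<nu> \<le> 1"
  shows "- arccot (2 * \<nu>) \<le> ImL pi (\<nu> - 1/2)"
proof -
  have pi: "0 < pi" "pi < 2 * pi" by auto
  have K: "Im (kern \<nu> (Complex pi y)) = exp (- \<nu> * y) * cos (\<nu> * pi) / (2 * cosh (y / 2))" for y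
  proof -
    have "1 + (sinh (y / 2))\<^sup>2 = (cosh (y / 2))\<^sup>2" by (simp add: cosh_square_eq)
    then have "2 * (1 + (sinh (y / 2))\<^sup>2) = 2 * cosh (y / 2) * cosh (y / 2)" by (simp add: power2_eq_square)
    then show ?thesis unfolding Im_kern by (simp add: mult.assoc[symmetric] del: distrib_left_numeral)
  qed
  show ?thesis
  proof (cases "\<nu> \<le> 1 / 2")
    case True
    have c: "cos (\<nu> * pi) \<ge> 0" using assms True by (intro cos_ge_zero) (auto intro: order_trans[of _ 0])
    have "- ImL pi (\<nu> - 1/2) \<le> 0"
    proof (rule le_of_exp_error)
      fix Y :: real assume "Y \<ge> 1"
      have "0 \<le> Im (vert_integral \<nu> pi Y)"
        unfolding Im_vert_integral(1)[OF pi] using c by (intro integral_nonneg Im_vert_integral(2)[OF pi]) (auto simp: K)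
      then show "- ImL pi (\<nu> - 1/2) \<le> 0 + 4 * exp (- Y / 2)"
        using ImL_approx[of pi \<nu> Y] \<open>Y \<ge> 1\<close> assms by simp
    qed
    moreover have "arccot (2 * \<nu>) \<ge> 0" using arctan_ubound[of "2 * \<nu>"] by (simp add: arccot_def)
    ultimately show ?thesis by linarith
  next
    case False
    define a where "a = 2 * \<nu>"
    have a: "1 \<le> a" "a \<le> 2" using False assms by (auto simp: a_def)
    define B where "B = (\<lambda>y. exp (- (\<nu> + 1/2) * y) / (\<nu> + 1/2) - 2 / 3 * (exp (- (\<nu> + 3/2) * y) / (\<nu> + 3/2)) + exp (- (\<nu> + 5/2) * y) / (\<nu> + 5/2) / 5)"
    define b where "b = (\<lambda>y. exp (- (\<nu> + 1/2) * y) - 2 / 3 * exp (- (\<nu> + 3/2) * y) + exp (- (\<nu> + 5/2) * y) / 5)"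
    have E: "((\<lambda>y. exp (- p * y) / p) has_real_derivative - exp (- p * y)) (at y within U)" if "p > 0" for p y U
      using that by (auto intro!: derivative_eq_intros)
    have B: "((\<lambda>y. - B y) has_real_derivative b y) (at y within U)" for y U
    proof -
      have "\<nu> + 1/2 > 0" "\<nu> + 3/2 > 0" "\<nu> + 5/2 > 0" using assms by auto
      note D = this[THEN E[of _ y U]]
      show ?thesis
        unfolding B_def
        by (rule DERIV_cong[OF DERIV_minus[OF DERIV_add[OF DERIV_diff[OF D(1) DERIV_cmult[OF D(2), of "2 / 3"]]
              DERIV_cdivide[OF D(3), of 5]]]]) (simp add: b_def)
    qed
    have kb: "- Im (kern \<nu> (Complex pi y)) \<le> b y" for y
    proof -
      have "2 * cosh (y / 2) = exp (y / 2) * (1 + exp (- y))"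
        unfolding distrib_left exp_add[symmetric] by (simp add: cosh_field_def)
      moreover have "exp (- \<nu> * y) / exp (y / 2) = exp (- (\<nu> + 1/2) * y)"
        unfolding exp_diff[symmetric] by (rule arg_cong[of _ _ exp]) (simp add: algebra_simps)
      ultimately have "exp (- \<nu> * y) / (2 * cosh (y / 2)) = exp (- (\<nu> + 1/2) * y) * (1 / (1 + exp (- y)))"
        by (simp only: divide_divide_eq_left[symmetric] times_divide_eq_right mult_1_right)
      also have "\<dots> \<le> exp (- (\<nu> + 1/2) * y) * (1 - 2 / 3 * exp (- y) + (exp (- y))\<^sup>2 / 5)"
        by (intro mult_left_mono inverse_one_plus_le) auto
      also have "\<dots> = exp (- (\<nu> + 1/2) * y) - 2 / 3 * (exp (- (\<nu> + 1/2) * y) * exp (- y)) +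
          exp (- (\<nu> + 1/2) * y) * exp (- y) * exp (- y) / 5"
      proof -
        have "E * (1 - 2 / 3 * e + e\<^sup>2 / 5) = E - 2 / 3 * (E * e) + E * e * e / 5" for E e :: real
          by (simp add: power2_eq_square algebra_simps)
        then show ?thesis .
      qed
      also have "exp (- (\<nu> + 1/2) * y) * exp (- y) = exp (- (\<nu> + 3/2) * y)"
        unfolding exp_add[symmetric] by (rule arg_cong[of _ _ exp]) (simp add: algebra_simps)
      also have "exp (- (\<nu> + 3/2) * y) * exp (- y) = exp (- (\<nu> + 5/2) * y)"
        unfolding exp_add[symmetric] by (rule arg_cong[of _ _ exp]) (simp add: algebra_simps)
      also have "exp (- (\<nu> + 1/2) * y) - 2 / 3 * exp (- (\<nu> + 3/2) * y) + exp (- (\<nu> + 5/2) * y) / 5 = b y"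
        by (simp only: b_def)
      finally have le: "exp (- \<nu> * y) / (2 * cosh (y / 2)) \<le> b y" .
      have "- cos (\<nu> * pi) * (exp (- \<nu> * y) / (2 * cosh (y / 2))) \<le> 1 * (exp (- \<nu> * y) / (2 * cosh (y / 2)))"
        using cos_ge_minus_one[of "\<nu> * pi"] by (intro mult_right_mono) auto
      with le show ?thesis unfolding K by (simp add: mult.commute)
    qed
    have B0: "B y \<ge> 0" if "y \<ge> 0" for y
    proof -
      have "2 / 3 * (exp (- (\<nu> + 3/2) * y) / (\<nu> + 3/2)) \<le> 1 * (exp (- (\<nu> + 1/2) * y) / (\<nu> + 1/2))"
        using assms that by (intro mult_mono frac_le) (auto intro: mult_right_mono)
      moreover have "exp (- (\<nu> + 5/2) * y) / (\<nu> + 5/2) / 5 \<ge> 0" using assms by simp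
      ultimately show ?thesis unfolding B_def by linarith
    qed
    have "- ImL pi (\<nu> - 1/2) \<le> B 0"
    proof (rule le_of_exp_error)
      fix Y :: real assume Y: "Y \<ge> 1"
      have b: "(b has_integral - B Y - - B 0) {0..Y}"
        using Y B by (intro fundamental_theorem_of_calculus)
          (auto simp: has_real_derivative_iff_has_vector_derivative[symmetric])
      have k: "((\<lambda>y. - Im (kern \<nu> (Complex pi y))) has_integral - Im (vert_integral \<nu> pi Y)) {0..Y}"
        unfolding Im_vert_integral(1)[OF pi] using Im_vert_integral(2)[OF pi]
        by (intro has_integral_neg integrable_integral)
      have "- Im (vert_integral \<nu> pi Y) \<le> - B Y - - B 0"
        by (rule has_integral_le[OF k b kb])
      then show "- ImL pi (\<nu> - 1/2) \<le> B 0 + 4 * exp (- Y / 2)"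
        using ImL_approx[of pi \<nu> Y] Y assms B0[of Y] by simp
    qed
    also have "B 0 = 2 / (a + 1) - 4 / 3 / (a + 3) + 2 / 5 / (a + 5)"
    proof -
      have "1 / (\<nu> + 1/2) = 2 / (a + 1)" "1 / (\<nu> + 3/2) = 2 / (a + 3)" "1 / (\<nu> + 5/2) = 2 / (a + 5)"
        using a by (simp_all add: a_def field_simps)
      then show ?thesis unfolding B_def mult_zero_right exp_zero by simp
    qed
    also have "\<dots> \<le> 3 * a / (3 * a\<^sup>2 + 1)"
    proof -
      \<comment> \<open>Convexity on [1, 2]: each power of \<open>a\<close> lies below its chord.
        After these substitutions the quintic-free difference below is at least 42a + 6.\<close>
      have a2: "a\<^sup>2 \<le> 3 * a - 2"
      proof -
        have "0 \<le> (a - 1) * (2 - a)" using a by simp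
        then show ?thesis by (simp add: algebra_simps power2_eq_square)
      qed
      have a3: "a ^ 3 \<le> 7 * a - 6"
      proof -
        have "0 \<le> (a - 1) * (2 - a) * (a + 3)" using a by simp
        then show ?thesis by (simp add: algebra_simps power2_eq_square power3_eq_cube)
      qed
      have a4: "a ^ 4 \<le> 15 * a - 14"
      proof -
        have "0 \<le> (a - 1) * (2 - a) * (a\<^sup>2 + 3 * a + 7)" using a by (intro mult_nonneg_nonneg add_nonneg_nonneg) auto
        also have "\<dots> = 15 * a - 14 - a ^ 4" by algebra
        finally show ?thesis by simp
      qed
      have "0 \<le> 531 * a - 368 - 3 * a ^ 4 - 27 * a ^ 3 - 85 * a\<^sup>2" using a a2 a3 a4 by linarith
      also have "\<dots> = 45 * a * ((a + 1) * (a + 3) * (a + 5)) -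
         (30 * ((a + 3) * (a + 5)) - 20 * ((a + 1) * (a + 5)) + 6 * ((a + 1) * (a + 3))) * (3 * a\<^sup>2 + 1)"
        by algebra
      finally have "(30 * ((a + 3) * (a + 5)) - 20 * ((a + 1) * (a + 5)) + 6 * ((a + 1) * (a + 3))) * (3 * a\<^sup>2 + 1)
         \<le> 3 * a * (15 * ((a + 1) * (a + 3) * (a + 5)))" by simp
      moreover have "2 / (a + 1) - 4 / 3 / (a + 3) + 2 / 5 / (a + 5) =
        (30 * ((a + 3) * (a + 5)) - 20 * ((a + 1) * (a + 5)) + 6 * ((a + 1) * (a + 3))) / (15 * ((a + 1) * (a + 3) * (a + 5)))"
        using a by (simp add: divide_simps) algebra
      moreover have "15 * ((a + 1) * (a + 3) * (a + 5)) > 0" "3 * a\<^sup>2 + 1 > 0"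
        using a by (auto intro!: mult_pos_pos add_nonneg_pos)
      ultimately show ?thesis by (simp only: pos_divide_le_eq pos_le_divide_eq frac_le_eq divide_le_eq times_divide_eq_left if_True)
    qed
    also have "\<dots> \<le> arccot a" using a by (intro arccot_ge) auto
    finally show ?thesis by (simp add: a_def)
  qed
qed

lemma arccot_antimono: "a \<le> b \<Longrightarrow> arccot b \<le> arccot a"
  using arctan_monotone'[of a b] by (simp add: arccot_def)

text \<open>Moving from \<open>x\<close> right to \<open>z\<close> lowers both \<open>ImL\<close>
  and arccot, so the lower bound at \<open>z\<close> implies the one at \<open>x\<close>.\<close>

lemma ImL_ge_of_le_2:
  assumes x: "0 < x" "x \<le> pi" and \<nu>: "\<nu> \<ge> 0" and a2: "2 * \<nu> * sin (x / 2) \<le> 2"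
  shows "- arccot (2 * \<nu> * sin (x / 2)) \<le> ImL x (\<nu> - 1/2)"
proof -
  \<comment> \<open>The last point of [0, \<pi>] up to which \<open>sin (\<nu> * t)\<close> is
    guaranteed nonnegative. The case split also handles \<open>\<nu> = 0\<close>, where
    \<open>pi / \<nu>\<close> would be 0.\<close>
  define z where "z = (if \<nu> \<le> 1 then pi else pi / \<nu>)"
  have "\<nu> * x \<le> pi"
  proof -
    have "x \<le> pi * sin (x / 2)" using jordan_inequality[of "x / 2"] x by simp
    then have "\<nu> * x \<le> \<nu> * (pi * sin (x / 2))" using \<nu> by (intro mult_left_mono)
    also have "\<dots> = pi * (2 * \<nu> * sin (x / 2)) / 2" by simp
    also have "\<dots> \<le> pi * 2 / 2" using a2 by (intro divide_right_mono mult_left_mono) auto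
    finally show ?thesis by simp
  qed
  then have z: "x \<le> z" "z \<le> pi" "\<nu> * z \<le> pi"
    using x \<nu> by (auto simp: z_def field_simps)
  \<comment> \<open>The comparison function is the constant 0, so this says that \<open>ImL\<close>
    does not increase from \<open>x\<close> to \<open>z\<close>.\<close>
  have "ImL z (\<nu> - 1/2) - ImL x (\<nu> - 1/2) \<le> 0 - 0"
  proof (rule ImL_diff_le[OF x(1) z(1,2) \<nu>])
    fix t assume t: "x \<le> t" "t \<le> z"
    have "\<nu> * t \<le> \<nu> * z" using t \<nu> by (intro mult_left_mono)
    then have "sin (\<nu> * t) \<ge> 0" using t x z \<nu> by (intro sin_ge_zero) auto
    moreover have "sin (t / 2) \<ge> 0" using t x z by (intro sin_ge_zero) auto
    ultimately show "- sin (\<nu> * t) / (2 * sin (t / 2)) \<le> 0" by simp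
  qed simp
  moreover have "- arccot (2 * \<nu> * sin (z / 2)) \<le> ImL z (\<nu> - 1/2)"
  proof (cases "\<nu> \<le> 1")
    case True
    then show ?thesis using ImL_pi_ge[OF \<nu>] by (simp add: z_def)
  next
    case False
    \<comment> \<open>As \<open>\<nu> * z = pi\<close>, Jordan's inequality at \<open>z / 2\<close>
      gives \<nu> sin(z/2) \<ge> 1, which places \<open>z\<close> in the range of the norm
      estimate.\<close>
    have "2 * (z / 2) \<le> pi * sin (z / 2)" using z x by (intro jordan_inequality) auto
    then have "\<nu> * z \<le> \<nu> * (pi * sin (z / 2))" using \<nu> by (intro mult_left_mono) auto
    moreover have "\<nu> * z = pi" using False by (simp add: z_def)
    ultimately have "pi * 1 \<le> pi * (\<nu> * sin (z / 2))" by (simp add: mult_ac)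
    then have "2 * \<nu> * sin (z / 2) \<ge> 2" by simp
    then show ?thesis using abs_ImL_le_of_ge_2[of z \<nu>] z x \<nu> by auto
  qed
  moreover have "arccot (2 * \<nu> * sin (z / 2)) \<le> arccot (2 * \<nu> * sin (x / 2))"
    using x z \<nu> by (intro arccot_antimono mult_left_mono sin_monotone_2pi_le) auto
  ultimately show ?thesis by linarith
qed

theorem theorem4:
  fixes \<mu> x :: real
  assumes "\<mu> \<ge> -1/2" and "0 \<le> x" and "x \<le> pi"
  shows "\<bar>ImL x \<mu>\<bar> \<le> arccot ((2 * \<mu> + 1) * sin (x / 2)) \<and>
         ((\<mu> = -1/2 \<or> x = 0) \<longrightarrow> \<bar>ImL x \<mu>\<bar> = arccot ((2 * \<mu> + 1) * sin (x / 2)))"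
proof -
  define \<nu> where "\<nu> = \<mu> + 1/2"
  have \<nu>: "\<nu> \<ge> 0" and \<mu>: "\<mu> = \<nu> - 1/2" using assms by (auto simp: \<nu>_def)
  \<comment> \<open>In both equality cases the argument of arccot is 0, so the bound is \<pi>/2 as
    well.\<close>
  have val: "ImL x \<mu> = pi / 2" if "\<mu> = -1/2 \<or> x = 0"
    using that ImL_0[OF \<nu>] ImL_minus_half[of x] assms \<mu> by (cases "x = 0") auto
  have eq: "\<bar>ImL x \<mu>\<bar> = arccot ((2 * \<mu> + 1) * sin (x / 2))" if "\<mu> = -1/2 \<or> x = 0"
  proof -
    have "(2 * \<mu> + 1) * sin (x / 2) = 0" using that by auto
    then show ?thesis using val[OF that] by (simp only:) (simp add: arccot_def)
  qed
  have "\<bar>ImL x \<mu>\<bar> \<le> arccot (2 * \<nu> * sin (x / 2))" if "x > 0"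
    using that assms \<nu> abs_ImL_le_of_ge_2[of x \<nu>] ImL_le_of_le_2[of x \<nu>] ImL_ge_of_le_2[of x \<nu>]
    unfolding \<mu> by linarith
  then show ?thesis using eq assms by (cases "x = 0") (auto simp: \<nu>_def)
qed

end
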